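(* Let $p\in(0,\infty]$ and $0<R<\infty$, and let $$\mathfrak B_p^d(R)=\Bigl\{(x,\omega)\in\mathbb{R}^{2d}:\sum_{i=1}^d|x_i+i\omega_i|^p\le R^p\Bigr\}$$ (with $\max_i|x_i+i\omega_i|\le R$ when $p=\infty$). The eigenfunctions of the Weyl transform $L_{\chi_{\mathfrak B_p^d(R)}}=\chi_{\mathfrak B_p^d(R)}\star 2^dP$ are the product Hermite functions, and the eigenvalue corresponding to $\phi_n$, $n\in\mathbb{N}_0^d$, is $$\lambda_n=(4\pi)^d(-1)^{|n|}\int_{W_p(R)}\prod_{j=1}^d\Bigl(e^{-2\pi r_j^2}L_{n_j}^0(4\pi r_j^2)\,r_j\Bigr)\,dr,$$ where $W_p(R)=\{r\in[0,\infty)^d:\sum_{i=1}^dr_i^p\le R^p\}$ (with $\max_ir_i\le R$ when $p=\infty$).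
   Context: The Wigner distribution is $W(f,g)(x,\omega)=\int_{\mathbb{R}^d}f(x+\tfrac t2)\overline{g(x-\tfrac t2)}e^{-2\pi i\langle\omega,t\rangle}\,dt$, and the Weyl transform $L_F$ of $F$ is the operator with $\langle L_Ff,g\rangle=\langle F,W(g,f)\rangle$. $P$ is the parity operator $Pf(t)=f(-t)$, and $F\star S=\int_{\mathbb{R}^{2d}}F(z)\pi(z)S\pi(z)^*\,dz$ (weakly), with $\pi(x,\omega)g(t)=e^{2\pi i\langle t,\omega\rangle}g(t-x)$; one has $L_F=F\star 2^dP$. $\chi_\Omega$ is the characteristic function of $\Omega$. Hermite functions: $\phi_n(t)=\frac{2^{1/4}}{\sqrt{n!}}\bigl(\frac{-1}{2\sqrt{\pi}}\bigr)^ne^{\pi t^2}\frac{d^n}{dt^n}(e^{-2\pi t^2})$ for $n\in\mathbb{N}_0$, and $\phi_n(t)=\prod_j\phi_{n_j}(t_j)$ for $n\in\mathbb{N}_0^d$; they form an orthonormal basis of $L^2(\mathbb{R}^d)$. $|n|=\sum_jn_j$, and $L_n^0(t)=\sum_{j=0}^n(-1)^j\binom{n}{n-j}\frac{t^j}{j!}$ is the Laguerre polynomial. *)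

theory Defs
  imports "HOL-Analysis.Analysis"
begin

text \<open>
  Elements of \<open>L\<^sup>2\<close> are represented by Borel functions, two of which are identified when they agree
  almost everywhere.  The inner product is linear in the first argument; it also serves as the
  bracket \<open>\<langle>F, W(g,f)\<rangle>\<close>, where \<open>F\<close> need not be in \<open>L\<^sup>2\<close>.
\<close>

definition L2 :: "('a::euclidean_space \<Rightarrow> complex) set" where
  "L2 = {f \<in> borel_measurable lborel. integrable lborel (\<lambda>x. (cmod (f x))\<^sup>2)}"

definition L2_inner :: "('a::euclidean_space \<Rightarrow> complex) \<Rightarrow> ('a \<Rightarrow> complex) \<Rightarrow> complex" where
  "L2_inner f g = (\<integral>x. f x * cnj (g x) \<partial>lborel)"

type_synonym 'd phase = "(real^'d) \<times> (real^'d)"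
type_synonym 'd operator = "(real^'d \<Rightarrow> complex) \<Rightarrow> (real^'d \<Rightarrow> complex)"

definition wigner ::
    "(real^'d \<Rightarrow> complex) \<Rightarrow> (real^'d \<Rightarrow> complex) \<Rightarrow> 'd::finite phase \<Rightarrow> complex" where
  "wigner f g = (\<lambda>(x, w). \<integral>t. f (x + t /\<^sub>R 2) * cnj (g (x - t /\<^sub>R 2))
                              * exp (- 2 * pi * \<i> * of_real (w \<bullet> t)) \<partial>lborel)"

text \<open>
  The weak identities below determine \<open>L f\<close> up to null sets; integrability is required so that the
  default value of a divergent integral plays no role.
\<close>

definition is_weyl_transform ::
    "('d::finite phase \<Rightarrow> complex) \<Rightarrow> 'd operator \<Rightarrow> bool" where
  "is_weyl_transform F L \<longleftrightarrow>
     (\<forall>f\<in>L2. L f \<in> L2 \<and>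
       (\<forall>g\<in>L2. integrable lborel (\<lambda>z. F z * cnj (wigner g f z)) \<and>
               L2_inner (L f) g = L2_inner F (wigner g f)))"

definition weyl_transform :: "('d::finite phase \<Rightarrow> complex) \<Rightarrow> 'd operator" where
  "weyl_transform F = (SOME L. is_weyl_transform F L)"

definition parity :: "'d::finite operator" where
  "parity f = (\<lambda>t. f (- t))"

definition tf_shift :: "'d::finite phase \<Rightarrow> 'd operator" where
  "tf_shift = (\<lambda>(x, w) f t. exp (2 * pi * \<i> * of_real (t \<bullet> w)) * f (t - x))"

definition tf_shift_adj :: "'d::finite phase \<Rightarrow> 'd operator" where
  "tf_shift_adj = (\<lambda>(x, w) f t. exp (- 2 * pi * \<i> * of_real ((t + x) \<bullet> w)) * f (t + x))"

lemma tf_shift_adjoint: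
  assumes "f \<in> L2" and "g \<in> L2"
  shows "L2_inner (tf_shift z f) g = L2_inner f (tf_shift_adj z g)"
proof (cases z)
  case (Pair x w)
  have [measurable]: "f \<in> borel_measurable borel" "g \<in> borel_measurable borel"
    using assms by (simp_all add: L2_def)
  have [measurable]: "tf_shift z f \<in> borel_measurable borel"
    unfolding Pair tf_shift_def by simp
  have [measurable]: "cnj \<in> borel_measurable borel"
    by (intro borel_measurable_continuous_onI continuous_intros)
  have E: "exp (2 * pi * \<i> * of_real ((t + x) \<bullet> w))
             = cnj (exp (- 2 * pi * \<i> * of_real ((t + x) \<bullet> w)))" for t
    by (simp add: exp_cnj)
  have "(\<integral>t. tf_shift z f t * cnj (g t) \<partial>lborel)
          = (\<integral>t. tf_shift z f t * cnj (g t) \<partial>distr lborel borel ((+) x))"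
    by (simp add: lborel_distr_plus)
  also have "\<dots> = (\<integral>t. tf_shift z f (x + t) * cnj (g (x + t)) \<partial>lborel)"
    by (rule integral_distr) measurable
  also have "\<dots> = (\<integral>t. f t * cnj (tf_shift_adj z g t) \<partial>lborel)"
    using E by (simp add: Pair tf_shift_def tf_shift_adj_def add.commute mult_ac)
  finally show ?thesis
    by (simp add: L2_inner_def)
qed

definition is_op_convolution ::
    "('d::finite phase \<Rightarrow> complex) \<Rightarrow> 'd operator \<Rightarrow> 'd operator \<Rightarrow> bool" where
  "is_op_convolution F S L \<longleftrightarrow>
     (\<forall>f\<in>L2. L f \<in> L2 \<and>
       (\<forall>g\<in>L2.
          integrable lborel (\<lambda>z. F z * L2_inner (tf_shift z (S (tf_shift_adj z f))) g) \<and>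
          L2_inner (L f) g =
            (\<integral>z. F z * L2_inner (tf_shift z (S (tf_shift_adj z f))) g \<partial>lborel)))"

definition op_convolution ::
    "('d::finite phase \<Rightarrow> complex) \<Rightarrow> 'd operator \<Rightarrow> 'd operator"  (infixl "\<star>" 70) where
  "F \<star> S = (SOME L. is_op_convolution F S L)"

definition is_eigenfunction ::
    "'d::finite operator \<Rightarrow> complex \<Rightarrow> (real^'d \<Rightarrow> complex) \<Rightarrow> bool" where
  "is_eigenfunction L \<mu> f \<longleftrightarrow>
     f \<in> L2 \<and> \<not> (AE t in lborel. f t = 0) \<and> (AE t in lborel. L f t = \<mu> * f t)"

definition is_orthonormal_basis :: "('i \<Rightarrow> 'a::euclidean_space \<Rightarrow> complex) \<Rightarrow> bool" where
  "is_orthonormal_basis e \<longleftrightarrow>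
     (\<forall>i. e i \<in> L2) \<and>
     (\<forall>i j. L2_inner (e i) (e j) = (if i = j then 1 else 0)) \<and>
     (\<forall>f\<in>L2. (\<forall>i. L2_inner f (e i) = 0) \<longrightarrow> (AE t in lborel. f t = 0))"

definition hermite_fun1 :: "nat \<Rightarrow> real \<Rightarrow> real" where
  "hermite_fun1 n t = 2 powr (1/4) / sqrt (fact n) * (- 1 / (2 * sqrt pi)) ^ n
     * exp (pi * t\<^sup>2) * (deriv ^^ n) (\<lambda>s. exp (- 2 * pi * s\<^sup>2)) t"

definition hermite_fun :: "nat^'d \<Rightarrow> real^'d::finite \<Rightarrow> complex" where
  "hermite_fun n t = of_real (\<Prod>j\<in>UNIV. hermite_fun1 (n $ j) (t $ j))"

definition laguerre :: "nat \<Rightarrow> real \<Rightarrow> real" where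
  "laguerre n t = (\<Sum>j=0..n. (- 1) ^ j * real (n choose (n - j)) * t ^ j / fact j)"

definition lp_phase_ball :: "ereal \<Rightarrow> real \<Rightarrow> 'd::finite phase set" where
  "lp_phase_ball p R = {(x, w).
     if p = \<infinity> then (MAX i. cmod (Complex (x $ i) (w $ i))) \<le> R
     else (\<Sum>i\<in>UNIV. cmod (Complex (x $ i) (w $ i)) powr real_of_ereal p)
            \<le> R powr real_of_ereal p}"

definition lp_radial_ball :: "ereal \<Rightarrow> real \<Rightarrow> (real^'d::finite) set" where
  "lp_radial_ball p R = {r. (\<forall>i. 0 \<le> r $ i) \<and>
     (if p = \<infinity> then (MAX i. r $ i) \<le> R
      else (\<Sum>i\<in>UNIV. (r $ i) powr real_of_ereal p) \<le> R powr real_of_ereal p)}"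

end

theory Submission
  imports Defs "HOL-Probability.Characteristic_Functions"
begin

text \<open>
  The statement rests on two facts: the cross-Wigner distributions of Hermite functions are explicit
  and transform by a character under rotations in each of the planes \<open>(x\<^sub>i, \<omega>\<^sub>i)\<close>, and the ball is
  polyradial, i.e. membership of a point depends only on the moduli of these \<open>d\<close> pairs.

  Substituting \<open>t = 2 (x - u)\<close> in the Wigner integral turns \<open>W(f,g)(z)\<close> into the matrix coefficient
  \<open>\<langle>\<pi>(z) 2\<^sup>d P \<pi>(z)\<^sup>* f, g\<rangle>\<close>.  So the Weyl transform and the convolution with \<open>2\<^sup>d P\<close> are characterised
  by literally the same weak identities (\<open>is_op_convolution_iff_is_weyl_transform\<close>).  Since
  the ball has finite measure, the superposition of these displaced parities over the ball
  is defined almost everywhere and maps \<open>L\<^sup>2\<close> to itself, by Fubini and Cauchy-Schwarz, which gives existence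
  (\<open>indicator_weyl_operator_is_weyl_transform\<close>).

  The matrix of the operator in the Hermite basis consists of the integrals of \<open>W(\<phi>\<^sub>n, \<phi>\<^sub>m)\<close> over the ball.
  In one dimension, integration by parts against the Gaussian yields the ladder recursions of
  \<open>W(\<phi>\<^sub>n, \<phi>\<^sub>m)\<close>, whose solution is a Gaussian times a polynomial in \<open>x - i \<omega>\<close> and \<open>x + i \<omega>\<close>
  (\<open>wigner_poly_eq\<close>).  From the recursion one reads off that rotating the plane by \<open>\<theta>\<close> multiplies
  \<open>W(\<phi>\<^sub>n, \<phi>\<^sub>m)\<close> by \<open>exp(i (m - n) \<theta>)\<close>, and from the solution with \<open>n = m\<close> that a Laguerre function
  appears.  If \<open>n\<close> and \<open>m\<close> differ in some coordinate \<open>j\<close>, a rotation of the \<open>j\<close>-th plane preserves the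
  ball and the measure but multiplies the integral by \<open>i\<close>, so the integral vanishes; if \<open>n = m\<close>, polar
  coordinates in every plane produce \<open>\<lambda>\<^sub>n\<close>.  Thus the matrix is diagonal, and completeness of the Hermite
  functions makes each of them an eigenfunction (\<open>polyradial_weyl_hermite\<close>).  As \<open>\<chi>\<close> is real, the
  operator is symmetric, so an orthonormal basis of eigenfunctions exhausts the
  eigenvalues (\<open>spectrum_from_eigenbasis\<close>).

  Completeness (\<open>hermite_fun_complete\<close>) is obtained by enlarging, one coordinate at a time, the set of
  one-dimensional factors whose tensor products are orthogonal to a given \<open>f\<close>: starting from Hermite
  functions, linear combinations and dominated limits lead to
  polynomials, exponentials, trigonometric polynomials and finally indicators of intervals, each times
  \<open>exp(-\<pi> t\<^sup>2)\<close>.  Hence \<open>f(t) exp(-\<pi> |t|\<^sup>2)\<close> has integral zero over every box and vanishes almost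
  everywhere.
\<close>

section \<open>Lebesgue measure as a product over coordinates\<close>

lemma borel_measurable_vec_lambda_raw [measurable (raw)]:
  fixes f :: "_ \<Rightarrow> 'd::finite \<Rightarrow> real"
  assumes "\<And>i. (\<lambda>x. f x i) \<in> borel_measurable M"
  shows "(\<lambda>x. \<chi> i. f x i) \<in> (borel_measurable M :: (_ \<Rightarrow> real^'d) set)"
  by (subst borel_measurable_euclidean_space)
     (auto simp: Basis_vec_def inner_axis assms)

interpretation lborel_PiM: product_sigma_finite "\<lambda>_. lborel :: 'a::euclidean_space measure"
  by standard

text \<open>
  The rotation of a single plane and the passage to moduli in all planes are both componentwise maps;
  a product measure is determined by its values on products of sets, on which preimages factor.
\<close>

lemma distr_PiM_componentwise:
  fixes M :: "'i::finite \<Rightarrow> 'a measure" and N :: "'i \<Rightarrow> 'b measure"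
  assumes "\<And>i. sigma_finite_measure (M i)" and "\<And>i. sigma_finite_measure (N i)"
    and meas: "\<And>i. T i \<in> measurable (M i) (N i)"
    and eq: "\<And>i. distr (M i) (N i) (T i) = N i"
  shows "distr (PiM UNIV M) (PiM UNIV N) (\<lambda>f i. T i (f i)) = PiM UNIV N"
proof -
  interpret M: product_sigma_finite M by (simp add: product_sigma_finite_def assms)
  interpret N: product_sigma_finite N by (simp add: product_sigma_finite_def assms)
  note [measurable] = meas
  have T: "(\<lambda>f i. T i (f i)) \<in> measurable (PiM UNIV M) (PiM UNIV N)"
    by (rule measurable_PiM_single') (auto simp: space_PiM intro: measurable_space[OF meas])
  show ?thesis
  proof (rule N.PiM_eqI)
    fix A assume A: "\<And>i. i \<in> UNIV \<Longrightarrow> A i \<in> sets (N i)"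
    have B: "T i -` A i \<inter> space (M i) \<in> sets (M i)" for i
      using A meas by (simp add: measurable_sets)
    have "emeasure (distr (PiM UNIV M) (PiM UNIV N) (\<lambda>f i. T i (f i))) (Pi\<^sub>E UNIV A)
        = emeasure (PiM UNIV M) ((\<lambda>f i. T i (f i)) -` (Pi\<^sub>E UNIV A) \<inter> space (PiM UNIV M))"
      using A by (intro emeasure_distr T sets_PiM_I_finite) auto
    also have "(\<lambda>f i. T i (f i)) -` (Pi\<^sub>E UNIV A) \<inter> space (PiM UNIV M)
                 = Pi\<^sub>E UNIV (\<lambda>i. T i -` A i \<inter> space (M i))"
      by (auto simp: space_PiM PiE_def Pi_def)
    also have "emeasure (PiM UNIV M) \<dots> = (\<Prod>i\<in>UNIV. emeasure (M i) (T i -` A i \<inter> space (M i)))"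
      using B by (intro M.emeasure_PiM) auto
    also have "\<dots> = (\<Prod>i\<in>UNIV. emeasure (distr (M i) (N i) (T i)) (A i))"
      using A meas by (simp add: emeasure_distr)
    finally show "emeasure (distr (PiM UNIV M) (PiM UNIV N) (\<lambda>f i. T i (f i))) (Pi\<^sub>E UNIV A)
        = (\<Prod>i\<in>UNIV. emeasure (N i) (A i))"
      by (simp add: eq)
  qed auto
qed

lemma measurable_vec_lambda [measurable]:
  "vec_lambda \<in> borel_measurable (PiM UNIV (\<lambda>_::'d::finite. lborel :: real measure))"
proof -
  have "(\<lambda>f. \<chi> i. f i) \<in> borel_measurable (PiM UNIV (\<lambda>_::'d. lborel :: real measure))"
    by measurable
  then show ?thesis by simp
qed

lemma prod_Basis_cart: "(\<Prod>b\<in>(Basis :: (real^'d) set). h b) = (\<Prod>i\<in>UNIV. h (axis i (1::real)))"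
proof -
  have *: "(Basis :: (real^'d) set) = range (\<lambda>i. axis i 1)" by (auto simp: Basis_vec_def)
  show ?thesis unfolding * by (subst prod.reindex) (auto simp: inj_on_def axis_eq_axis)
qed

lemma lborel_cart_eq_PiM:
  "(lborel :: (real^'d::finite) measure) = distr (PiM UNIV (\<lambda>_. lborel)) borel vec_lambda"
proof (rule lborel_eqI)
  fix l u :: "real^'d" assume *: "\<And>b. b \<in> Basis \<Longrightarrow> l \<bullet> b \<le> u \<bullet> b"
  have le: "l $ i \<le> u $ i" for i
    using *[of "axis i 1"] by (simp add: inner_axis)
  have "vec_lambda -` box l u \<inter> space (PiM UNIV (\<lambda>_::'d. lborel :: real measure))
          = Pi\<^sub>E UNIV (\<lambda>i. {l $ i <..< u $ i})"
    by (auto simp: space_PiM mem_box_cart PiE_def Pi_def)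
  then have "emeasure (distr (PiM UNIV (\<lambda>_. lborel)) borel vec_lambda) (box l u)
      = (\<Prod>i\<in>UNIV. emeasure lborel {l $ i <..< u $ i})"
    by (subst emeasure_distr) (auto simp: lborel_PiM.emeasure_PiM)
  also have "\<dots> = (\<Prod>b\<in>Basis. (u - l) \<bullet> b)"
    using le by (simp add: prod_Basis_cart inner_axis prod_ennreal)
  finally show "emeasure (distr (PiM UNIV (\<lambda>_. lborel)) borel vec_lambda) (box l u)
      = (\<Prod>b\<in>Basis. (u - l) \<bullet> b)" .
qed simp

text \<open>
  Regroups \<open>d\<close> planar points as a pair of vectors; it splits Lebesgue measure on phase space into \<open>d\<close> planar
  factors, on which rotations and polar coordinates act independently.
\<close>

definition to_phase :: "('d \<Rightarrow> real \<times> real) \<Rightarrow> 'd::finite phase" where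
  "to_phase f = (\<chi> i. fst (f i), \<chi> i. snd (f i))"

lemma measurable_to_phase [measurable]:
  "to_phase \<in> borel_measurable (PiM UNIV (\<lambda>_::'d::finite. lborel :: (real \<times> real) measure))"
proof -
  have [measurable]: "fst \<in> borel_measurable (borel :: (real \<times> real) measure)"
    "snd \<in> borel_measurable (borel :: (real \<times> real) measure)"
    by (intro borel_measurable_continuous_onI continuous_intros)+
  have "(\<lambda>f. fst (f i)) \<in> borel_measurable (PiM UNIV (\<lambda>_::'d. lborel :: (real \<times> real) measure))"
    "(\<lambda>f. snd (f i)) \<in> borel_measurable (PiM UNIV (\<lambda>_::'d. lborel :: (real \<times> real) measure))" for i
    by measurable
  then show ?thesis
    unfolding to_phase_def by (intro borel_measurable_Pair borel_measurable_vec_lambda_raw)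
qed

lemma lborel_phase_eq_PiM:
  "(lborel :: 'd::finite phase measure) = distr (PiM UNIV (\<lambda>_. lborel)) borel to_phase"
proof (rule lborel_eqI)
  fix l u :: "'d phase" assume *: "\<And>b. b \<in> Basis \<Longrightarrow> l \<bullet> b \<le> u \<bullet> b"
  have "(axis i 1, 0) \<in> (Basis :: 'd phase set)" "(0, axis i 1) \<in> (Basis :: 'd phase set)" for i
    by (auto simp: Basis_prod_def)
  with * have le: "fst l $ i \<le> fst u $ i" "snd l $ i \<le> snd u $ i" for i
    by (force simp: inner_prod_def inner_axis)+
  define A where "A i = box (fst l $ i, snd l $ i) (fst u $ i, snd u $ i)" for i
  have A: "emeasure lborel (A i) = ennreal ((fst u $ i - fst l $ i) * (snd u $ i - snd l $ i))" for i
    using le[of i] unfolding A_def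
    by (subst emeasure_lborel_box) 
       (auto simp: Basis_prod_def inner_prod_def)
  have "to_phase -` box l u \<inter> space (PiM UNIV (\<lambda>_::'d. lborel :: (real \<times> real) measure)) = Pi\<^sub>E UNIV A"
  proof -
    have P: "x \<in> box a b \<longleftrightarrow> fst x \<in> box (fst a) (fst b) \<and> snd x \<in> box (snd a) (snd b)"
      for x a b :: "'x::euclidean_space \<times> 'y::euclidean_space"
      by (auto simp: mem_box Basis_prod_def inner_prod_def ball_Un)
    show ?thesis
      by (auto simp: space_PiM mem_box_cart PiE_def Pi_def to_phase_def A_def P)
  qed
  then have "emeasure (distr (PiM UNIV (\<lambda>_. lborel)) borel to_phase) (box l u)
      = (\<Prod>i\<in>UNIV. emeasure lborel (A i))"
    by (subst emeasure_distr) (auto simp: lborel_PiM.emeasure_PiM A_def)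
  also have "\<dots> = (\<Prod>i\<in>UNIV. fst u $ i - fst l $ i) * (\<Prod>i\<in>UNIV. snd u $ i - snd l $ i)"
    using le by (simp add: A prod_ennreal prod.distrib)
  also have "\<dots> = (\<Prod>b\<in>Basis. (u - l) \<bullet> b)"
  proof -
    have 1: "(\<lambda>b. (b, 0)) ` (Basis :: (real^'d) set) \<inter> (\<lambda>b. (0, b)) ` Basis = {}" by auto
    show ?thesis unfolding Basis_prod_def
      apply (subst prod.union_disjoint[OF _ _ 1])
        apply (simp_all add: prod.reindex inj_on_def)
      by (simp add: inner_prod_def prod_Basis_cart inner_axis)
  qed
  finally show "emeasure (distr (PiM UNIV (\<lambda>_. lborel)) borel to_phase) (box l u)
      = (\<Prod>b\<in>Basis. (u - l) \<bullet> b)" .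
qed simp

section \<open>Rotations and polar coordinates\<close>

lemma integrable_prod_cart:
  fixes g :: "'d::finite \<Rightarrow> real \<Rightarrow> 'b::{real_normed_field,banach,second_countable_topology}"
  assumes g: "\<And>i. integrable lborel (g i)"
  shows "integrable lborel (\<lambda>t::real^'d. \<Prod>i\<in>UNIV. g i (t $ i))"
    and "(\<integral>t. (\<Prod>i\<in>UNIV. g i ((t :: real^'d) $ i)) \<partial>lborel) = (\<Prod>i\<in>UNIV. \<integral>s. g i s \<partial>lborel)"
proof -
  have [measurable]: "g i \<in> borel_measurable borel" for i
    using borel_measurable_integrable[OF g] by simp
  show "integrable lborel (\<lambda>t::real^'d. \<Prod>i\<in>UNIV. g i (t $ i))"
    unfolding lborel_cart_eq_PiM
    by (subst integrable_distr_eq)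
       (auto intro!: lborel_PiM.product_integrable_prod g)
  show "(\<integral>t. (\<Prod>i\<in>UNIV. g i ((t :: real^'d) $ i)) \<partial>lborel) = (\<Prod>i\<in>UNIV. \<integral>s. g i s \<partial>lborel)"
    unfolding lborel_cart_eq_PiM
    by (subst integral_distr)
       (auto intro!: lborel_PiM.product_integral_prod g)
qed

lemma emeasure_lborel_translate:
  fixes A :: "'a::euclidean_space set"
  assumes [measurable]: "A \<in> sets borel"
  shows "emeasure lborel ((\<lambda>x. x + c) -` A) = emeasure lborel A"
proof -
  have "emeasure lborel A = emeasure (distr lborel borel ((+) c)) A"
    by (simp add: lborel_distr_plus)
  also have "\<dots> = emeasure lborel ((+) c -` A)"
    by (subst emeasure_distr) auto
  finally show ?thesis by (simp add: add.commute vimage_def)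
qed

text \<open>
  By Fubini, since on each horizontal (or vertical) line a shear is a translation.
\<close>

lemma distr_lborel_shear:
  fixes c :: real
  shows "distr lborel borel (\<lambda>(x, y). (x + c * y, y)) = lborel" 
    and "distr lborel borel (\<lambda>(x, y). (x, y + c * x)) = lborel"
proof -
  have m1 [measurable]: "(\<lambda>(x, y). (x + c * y, y)) \<in> borel_measurable (borel :: (real \<times> real) measure)"
    and m2 [measurable]: "(\<lambda>(x, y). (x, y + c * x)) \<in> borel_measurable (borel :: (real \<times> real) measure)"
    by (auto intro!: borel_measurable_continuous_onI continuous_intros simp: case_prod_beta)
  show "distr lborel borel (\<lambda>(x, y). (x + c * y, y)) = lborel"
  proof (rule measure_eqI)
    fix A assume "A \<in> sets (distr lborel borel (\<lambda>(x::real, y). (x + c * y, y)))"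
    then have A [measurable]: "A \<in> sets borel" by simp
    have A': "(\<lambda>(x, y). (x + c * y, y)) -` A \<in> sets borel"
      using measurable_sets[OF m1 A] by simp
    have s: "(\<lambda>x. (x, y)) -` A \<in> sets borel" for y
    proof -
      have "(\<lambda>x. (x, y)) \<in> borel_measurable borel"
        by (intro borel_measurable_continuous_onI continuous_intros)
      from measurable_sets[OF this A] show ?thesis by simp
    qed
    have "emeasure (distr lborel borel (\<lambda>(x, y). (x + c * y, y))) A
        = emeasure (lborel \<Otimes>\<^sub>M lborel) ((\<lambda>(x, y). (x + c * y, y)) -` A)"
      by (simp add: emeasure_distr lborel_prod)
    also have "\<dots> = (\<integral>\<^sup>+ y. emeasure lborel ((\<lambda>x. (x, y)) -` (\<lambda>(x, y). (x + c * y, y)) -` A) \<partial>lborel)"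
      using A' by (intro lborel_pair.emeasure_pair_measure_alt2) (simp only: lborel_prod sets_lborel)
    also have "\<dots> = (\<integral>\<^sup>+ y. emeasure lborel ((\<lambda>x. x + c * y) -` ((\<lambda>x. (x, y)) -` A)) \<partial>lborel)"
      by (simp add: vimage_def)
    also have "\<dots> = (\<integral>\<^sup>+ y. emeasure lborel ((\<lambda>x. (x, y)) -` A) \<partial>lborel)"
      by (simp add: emeasure_lborel_translate s)
    also have "\<dots> = emeasure (lborel \<Otimes>\<^sub>M lborel) A"
      by (rule lborel_pair.emeasure_pair_measure_alt2[symmetric]) (use A in \<open>simp only: lborel_prod sets_lborel\<close>)
    finally show "emeasure (distr lborel borel (\<lambda>(x, y). (x + c * y, y))) A = emeasure lborel A"
      by (simp add: lborel_prod borel_prod)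
  qed simp
  show "distr lborel borel (\<lambda>(x, y). (x, y + c * x)) = lborel"
  proof (rule measure_eqI)
    fix A assume "A \<in> sets (distr lborel borel (\<lambda>(x, y::real). (x, y + c * x)))"
    then have A [measurable]: "A \<in> sets borel" by simp
    have A': "(\<lambda>(x, y). (x, y + c * x)) -` A \<in> sets borel"
      using measurable_sets[OF m2 A] by simp
    have s: "Pair x -` A \<in> sets borel" for x
    proof -
      have "Pair x \<in> borel_measurable borel"
        by (intro borel_measurable_continuous_onI continuous_intros)
      from measurable_sets[OF this A] show ?thesis by simp
    qed
    have "emeasure (distr lborel borel (\<lambda>(x, y). (x, y + c * x))) A
        = emeasure (lborel \<Otimes>\<^sub>M lborel) ((\<lambda>(x, y). (x, y + c * x)) -` A)"
      by (simp add: emeasure_distr lborel_prod)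
    also have "\<dots> = (\<integral>\<^sup>+ x. emeasure lborel (Pair x -` (\<lambda>(x, y). (x, y + c * x)) -` A) \<partial>lborel)"
      using A' by (intro lborel.emeasure_pair_measure_alt) (simp only: lborel_prod sets_lborel)
    also have "\<dots> = (\<integral>\<^sup>+ x. emeasure lborel ((\<lambda>y. y + c * x) -` (Pair x -` A)) \<partial>lborel)"
      by (simp add: vimage_def)
    also have "\<dots> = (\<integral>\<^sup>+ x. emeasure lborel (Pair x -` A) \<partial>lborel)"
      by (simp add: emeasure_lborel_translate s)
    also have "\<dots> = emeasure (lborel \<Otimes>\<^sub>M lborel) A"
      by (rule lborel.emeasure_pair_measure_alt[symmetric]) (use A in \<open>simp only: lborel_prod sets_lborel\<close>)
    finally show "emeasure (distr lborel borel (\<lambda>(x, y). (x, y + c * x))) A = emeasure lborel A"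
      by (simp add: lborel_prod borel_prod)
  qed simp
qed

definition rotate :: "real \<Rightarrow> real \<times> real \<Rightarrow> real \<times> real" where
  "rotate \<theta> = (\<lambda>(x, y). (cos \<theta> * x - sin \<theta> * y, sin \<theta> * x + cos \<theta> * y))"

lemma measurable_rotate [measurable]: "rotate \<theta> \<in> borel_measurable borel"
  unfolding rotate_def case_prod_beta
  by (intro borel_measurable_continuous_onI continuous_intros)

lemma norm_rotate [simp]: "norm (rotate \<theta> z) = norm z"
proof -
  have "(cos \<theta> * x - sin \<theta> * y)\<^sup>2 + (sin \<theta> * x + cos \<theta> * y)\<^sup>2 = ((cos \<theta>)\<^sup>2 + (sin \<theta>)\<^sup>2) * (x\<^sup>2 + y\<^sup>2)" for x y
    by algebra
  then show ?thesis by (cases z) (simp add: rotate_def norm_Pair)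
qed

text \<open>
  A rotation by \<open>\<theta>\<close> is the product of three shears, with parameter \<open>a = - tan (\<theta> / 2)\<close> for the outer two,
  which is why the half turn is excluded.
\<close>

lemma distr_lborel_rotate:
  assumes "cos \<theta> \<noteq> -1"
  shows "distr lborel borel (rotate \<theta>) = lborel"
proof -
  define c s where "c = cos \<theta>" and "s = sin \<theta>"
  have cs: "c\<^sup>2 + s\<^sup>2 = 1" by (simp add: c_def s_def)
  have c: "1 + c \<noteq> 0" using assms by (simp add: c_def add_eq_0_iff2)
  define a where "a = - s / (1 + c)"
  have ac: "a * (1 + c) = - s" using c by (simp add: a_def)
  have "(1 + c) * (1 + a * s - c) = 0" "(1 + c) * ((1 + c) * (2 * a + a\<^sup>2 * s + s)) = 0"
    using cs ac by algebra+
  then have a: "1 + a * s = c" "2 * a + a\<^sup>2 * s = - s"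
    using c by (simp_all add: add_eq_0_iff2)
  define S1 S2 :: "real \<times> real \<Rightarrow> real \<times> real"
    where "S1 = (\<lambda>(x, y). (x + a * y, y))" and "S2 = (\<lambda>(x, y). (x, y + s * x))"
  have m [measurable]: "S1 \<in> borel_measurable borel" "S2 \<in> borel_measurable borel"
    by (auto intro!: borel_measurable_continuous_onI continuous_intros simp: case_prod_beta S1_def S2_def)
  have d: "distr lborel borel S1 = lborel" "distr lborel borel S2 = lborel"
    by (simp_all add: S1_def S2_def distr_lborel_shear)
  have "rotate \<theta> = S1 \<circ> S2 \<circ> S1"
  proof (rule ext, safe)
    fix x y
    have "(S1 \<circ> S2 \<circ> S1) (x, y) = ((1 + a * s) * x + (2 * a + a\<^sup>2 * s) * y, s * x + (1 + a * s) * y)"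
      by (simp add: S1_def S2_def algebra_simps power2_eq_square)
    also have "\<dots> = rotate \<theta> (x, y)"
      unfolding a by (simp add: rotate_def c_def s_def)
    finally show "rotate \<theta> (x, y) = (S1 \<circ> S2 \<circ> S1) (x, y)" ..
  qed
  moreover have "distr lborel borel (S1 \<circ> S2 \<circ> S1)
      = distr (distr (distr lborel borel S1) borel S2) borel S1"
    by (simp add: distr_distr comp_assoc)
  ultimately show ?thesis by (simp add: d)
qed

text \<open>
  Polar coordinates for radial functions: both measures give \<open>{..x}\<close> the area \<open>\<pi> x\<^sup>2\<close> of a disc when \<open>x \<ge> 0\<close>,
  and half-lines determine a measure.
\<close>

lemma distr_lborel_norm:
  "distr lborel borel (norm :: real \<times> real \<Rightarrow> real)
     = density lborel (\<lambda>r. ennreal (2 * pi * r * indicator {0..} r))" (is "?M = ?N")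
proof (rule measure_eqI_generator_eq)
  let ?E = "range (\<lambda>x::real. {..x})"
  have N: "emeasure ?N {..x} = ennreal (pi * (max 0 x)\<^sup>2)" for x
  proof -
    have "emeasure ?N {..x} = (\<integral>\<^sup>+ r. ennreal (2 * pi * r) * indicator {0..max 0 x} r \<partial>lborel)"
      by (subst emeasure_density) 
         (auto intro!: nn_integral_cong simp: indicator_def max_def)
    also have "\<dots> = ennreal (pi * (max 0 x)\<^sup>2 - pi * 0\<^sup>2)"
      by (rule nn_integral_FTC_Icc) (auto intro!: derivative_eq_intros)
    finally show ?thesis by simp
  qed
  show "emeasure ?M X = emeasure ?N X" if "X \<in> ?E" for X
  proof -
    from that obtain x where X: "X = {..x}" by auto
    have "emeasure ?M X = emeasure lborel (if x < 0 then {} else cball (0::real \<times> real) x)"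
    proof -
      have "norm -` {..x} = (if x < 0 then {} else cball (0::real \<times> real) x)"
        by (auto dest: order_trans[OF norm_ge_zero])
      then show ?thesis by (subst emeasure_distr) (auto simp: X)
    qed
    also have "\<dots> = ennreal (pi * (max 0 x)\<^sup>2)"
      by (auto simp: emeasure_cball unit_ball_vol_2 power2_eq_square)
    finally show ?thesis using X N by simp
  qed
  show "Int_stable ?E" by (auto simp: Int_stable_def)
  show "sets ?M = sigma_sets UNIV ?E" "sets ?N = sigma_sets UNIV ?E"
    by (simp_all add: borel_eq_atMost)
  show "range (\<lambda>n::nat. {..real n}) \<subseteq> ?E" by auto
  show "(\<Union>n::nat. {..real n}) = UNIV" using real_arch_simple by auto
  show "emeasure ?M {..real n} \<noteq> \<infinity>" for n
    by (subst \<open>\<And>X. X \<in> ?E \<Longrightarrow> emeasure ?M X = emeasure ?N X\<close>) (simp_all add: N)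
qed auto

definition radii :: "'d::finite phase \<Rightarrow> real^'d" where
  "radii z = (\<chi> i. norm (fst z $ i, snd z $ i))"

lemma measurable_radii [measurable]: "radii \<in> borel_measurable borel"
proof -
  have "continuous_on UNIV (radii :: 'd::finite phase \<Rightarrow> _)"
    unfolding radii_def by (intro continuous_intros)
  then show ?thesis by (rule borel_measurable_continuous_onI)
qed

lemma radii_to_phase: "radii (to_phase f) = (\<chi> i. norm (f i))"
  by (simp add: radii_def to_phase_def)

text \<open>
  Polar coordinates in all planes at once: the map to the moduli pushes the product of planar Lebesgue
  measures to the product of the one-dimensional measures \<open>2 \<pi> r dr\<close>.
\<close>

lemma integral_polyradial:
  fixes H :: "real^'d::finite \<Rightarrow> real"
  assumes [measurable]: "H \<in> borel_measurable borel"
  shows "(\<integral>z. H (radii z) \<partial>lborel)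
       = (\<integral>r. (\<Prod>i\<in>UNIV. 2 * pi * r $ i * indicator {0..} (r $ i)) * H r \<partial>lborel)"
proof -
  define \<rho> :: "real \<Rightarrow> real" where "\<rho> r = 2 * pi * r * indicator {0..} r" for r
  have \<rho>_nonneg: "\<rho> r \<ge> 0" for r by (auto simp: \<rho>_def split: split_indicator)
  have [measurable]: "\<rho> \<in> borel_measurable borel" unfolding \<rho>_def by measurable
  define N where "N = density lborel (\<lambda>r. ennreal (\<rho> r))"
  have N: "distr lborel N (norm :: real \<times> real \<Rightarrow> real) = N"
    using distr_lborel_norm unfolding N_def \<rho>_def by (metis (no_types, lifting) distr_cong sets_density sets_lborel)
  have sf: "sigma_finite_measure N"
    unfolding N_def by (subst sigma_finite_measure.sigma_finite_iff_density_finite[OF sigma_finite_lborel]) auto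
  interpret N: product_sigma_finite "\<lambda>_::'d. N"
    using sf by (simp add: product_sigma_finite_def)
  have PN: "density (PiM UNIV (\<lambda>_::'d. lborel)) (\<lambda>f. ennreal (\<Prod>i\<in>UNIV. \<rho> (f i))) = PiM UNIV (\<lambda>_. N)"
  proof (rule N.PiM_eqI)
    show "sets (density (PiM UNIV (\<lambda>_::'d. lborel)) (\<lambda>f. ennreal (\<Prod>i\<in>UNIV. \<rho> (f i)))) = PiM UNIV (\<lambda>_. N)"
      by (auto simp: N_def intro!: sets_PiM_cong)
    fix A :: "'d \<Rightarrow> real set" assume "\<And>i. i \<in> UNIV \<Longrightarrow> A i \<in> sets N"
    then have A [measurable]: "A i \<in> sets borel" for i by (simp add: N_def)
    have "emeasure (density (PiM UNIV (\<lambda>_::'d. lborel)) (\<lambda>f. ennreal (\<Prod>i\<in>UNIV. \<rho> (f i)))) (Pi\<^sub>E UNIV A)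
        = (\<integral>\<^sup>+ f. ennreal (\<Prod>i\<in>UNIV. \<rho> (f i)) * indicator (Pi\<^sub>E UNIV A) f \<partial>PiM UNIV (\<lambda>_::'d. lborel))"
      by (rule emeasure_density) (auto intro!: sets_PiM_I_finite)
    also have "\<dots> = (\<integral>\<^sup>+ f. (\<Prod>i\<in>UNIV. ennreal (\<rho> (f i)) * indicator (A i) (f i)) \<partial>PiM UNIV (\<lambda>_::'d. lborel))"
    proof (intro nn_integral_cong)
      fix f :: "'d \<Rightarrow> real"
      have "indicator (Pi\<^sub>E UNIV A) f = (\<Prod>i\<in>UNIV. indicator (A i) (f i) :: ennreal)"
        by (auto simp: indicator_def PiE_def Pi_def)
      then show "ennreal (\<Prod>i\<in>UNIV. \<rho> (f i)) * indicator (Pi\<^sub>E UNIV A) f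
          = (\<Prod>i\<in>UNIV. ennreal (\<rho> (f i)) * indicator (A i) (f i))"
        by (simp add: prod.distrib prod_ennreal \<rho>_nonneg)
    qed
    also have "\<dots> = (\<Prod>i\<in>UNIV. \<integral>\<^sup>+ r. ennreal (\<rho> r) * indicator (A i) r \<partial>lborel)"
      by (rule lborel_PiM.product_nn_integral_prod) auto
    also have "\<dots> = (\<Prod>i\<in>UNIV. emeasure N (A i))"
      by (simp add: N_def emeasure_density)
    finally show "emeasure (density (PiM UNIV (\<lambda>_::'d. lborel)) (\<lambda>f. ennreal (\<Prod>i\<in>UNIV. \<rho> (f i)))) (Pi\<^sub>E UNIV A)
        = (\<Prod>i\<in>UNIV. emeasure N (A i))" .
  qed simp
  have mvN [measurable]: "vec_lambda \<in> borel_measurable (PiM UNIV (\<lambda>_::'d. N))"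
    using measurable_vec_lambda unfolding N_def by (simp cong: measurable_cong_sets sets_PiM_cong)
  have mnorm: "(\<lambda>f i. norm (f i)) \<in> measurable (PiM UNIV (\<lambda>_::'d. lborel :: (real \<times> real) measure)) (PiM UNIV (\<lambda>_. N))"
    unfolding N_def by (rule measurable_PiM_single') (auto simp: space_PiM)
  have "(\<integral>z. H (radii z) \<partial>lborel)
      = (\<integral>f. H (vec_lambda (\<lambda>i. norm (f i))) \<partial>PiM UNIV (\<lambda>_::'d. lborel :: (real \<times> real) measure))"
    unfolding lborel_phase_eq_PiM by (subst integral_distr) (auto simp: radii_to_phase)
  also have "\<dots> = (\<integral>g. H (vec_lambda g) \<partial>distr (PiM UNIV (\<lambda>_::'d. lborel :: (real \<times> real) measure)) (PiM UNIV (\<lambda>_. N)) (\<lambda>f i. norm (f i)))"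
    by (subst integral_distr[OF mnorm]) (auto intro!: measurable_compose[OF mvN])
  also have "distr (PiM UNIV (\<lambda>_::'d. lborel :: (real \<times> real) measure)) (PiM UNIV (\<lambda>_. N)) (\<lambda>f i. norm (f i)) = PiM UNIV (\<lambda>_. N)"
    by (rule distr_PiM_componentwise) (use sf N in \<open>auto simp: N_def intro: sigma_finite_lborel\<close>)
  also have "(\<integral>g. H (vec_lambda g) \<partial>PiM UNIV (\<lambda>_. N))
      = (\<integral>f. (\<Prod>i\<in>UNIV. \<rho> (f i)) *\<^sub>R H (vec_lambda f) \<partial>PiM UNIV (\<lambda>_::'d. lborel))"
    unfolding PN[symmetric]
    by (rule integral_density) (auto intro!: AE_I2 prod_nonneg \<rho>_nonneg)
  also have "\<dots> = (\<integral>r. (\<Prod>i\<in>UNIV. \<rho> (r $ i)) * H r \<partial>lborel)"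
    unfolding lborel_cart_eq_PiM by (subst integral_distr) auto
  finally show ?thesis by (simp add: \<rho>_def)
qed

section \<open>One-dimensional Hermite functions and Gaussian integrals\<close>

text \<open>
  The Hermite polynomials \<open>H\<^sub>n (\<surd>(2\<pi>) t)\<close> scaled by \<open>(2\<pi>)\<close> to the power \<open>n / 2\<close>, so that the \<open>n\<close>-th derivative of
  \<open>exp(-2 \<pi> t\<^sup>2)\<close> is \<open>(-1)\<^sup>n\<close> times this polynomial times \<open>exp(-2 \<pi> t\<^sup>2)\<close>.
\<close>

fun hermite_poly :: "nat \<Rightarrow> real \<Rightarrow> real" where
  "hermite_poly 0 t = 1"
| "hermite_poly (Suc 0) t = 4 * pi * t"
| "hermite_poly (Suc (Suc n)) t =
     4 * pi * t * hermite_poly (Suc n) t - 4 * pi * real (Suc n) * hermite_poly n t"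

lemma hermite_poly_Suc:
  "hermite_poly (Suc n) t = 4 * pi * t * hermite_poly n t - 4 * pi * real n * hermite_poly (n - 1) t"
  by (cases n) auto

lemma DERIV_hermite_poly:
  "(hermite_poly n has_real_derivative 4 * pi * real n * hermite_poly (n - 1) t) (at t)"
proof (induction n t rule: hermite_poly.induct)
  case (1 t) then show ?case by simp
next
  case (2 t) 
  have "hermite_poly (Suc 0) = (\<lambda>t. 4 * pi * t)" by auto
  then show ?case by (auto intro!: derivative_eq_intros)
next
  case (3 n t)
  have *: "hermite_poly (Suc (Suc n)) = (\<lambda>t. 4 * pi * t * hermite_poly (Suc n) t - 4 * pi * real (Suc n) * hermite_poly n t)"
    by auto
  show ?case unfolding *
    by (rule derivative_eq_intros 3 refl)+ (simp add: hermite_poly_Suc[of n] algebra_simps)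
qed

lemma DERIV_hermite_poly' [derivative_intros]:
  "(g has_real_derivative g') (at t) \<Longrightarrow> D = 4 * pi * real n * hermite_poly (n - 1) (g t) * g' \<Longrightarrow>
   ((\<lambda>t. hermite_poly n (g t)) has_real_derivative D) (at t)"
  using DERIV_chain2[OF DERIV_hermite_poly] by blast

lemma hermite_fun1_eq:
  "hermite_fun1 n t = 2 powr (1/4) / sqrt (fact n) * (1 / (2 * sqrt pi)) ^ n
     * hermite_poly n t * exp (- pi * t\<^sup>2)"
proof -
  have D: "(deriv ^^ n) (\<lambda>s. exp (- 2 * pi * s\<^sup>2)) = (\<lambda>s. (-1) ^ n * hermite_poly n s * exp (- 2 * pi * s\<^sup>2))"
  proof (induction n)
    case (Suc n)
    have "((\<lambda>s. (-1) ^ n * hermite_poly n s * exp (- 2 * pi * s\<^sup>2)) has_real_derivative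
            (-1) ^ Suc n * hermite_poly (Suc n) t * exp (- 2 * pi * t\<^sup>2)) (at t)" for t
      by (rule derivative_eq_intros refl)+ (simp add: hermite_poly_Suc[of n] algebra_simps)
    then have "deriv (\<lambda>s. (-1) ^ n * hermite_poly n s * exp (- 2 * pi * s\<^sup>2))
        = (\<lambda>s. (-1) ^ Suc n * hermite_poly (Suc n) s * exp (- 2 * pi * s\<^sup>2))"
      by (intro ext DERIV_imp_deriv)
    then show ?case by (simp only: funpow.simps o_apply Suc)
  qed simp
  have E: "exp (pi * t\<^sup>2) * exp (- 2 * pi * t\<^sup>2) = exp (- pi * t\<^sup>2)"
    by (simp flip: exp_add)
  have S: "(- 1 / (2 * sqrt pi)) ^ n * (- 1) ^ n = (1 / (2 * sqrt pi)) ^ n"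
    by (simp flip: power_mult_distrib)
  have "hermite_fun1 n t = 2 powr (1/4) / sqrt (fact n) * ((- 1 / (2 * sqrt pi)) ^ n * (- 1) ^ n)
     * hermite_poly n t * (exp (pi * t\<^sup>2) * exp (- 2 * pi * t\<^sup>2))"
    unfolding hermite_fun1_def D by (simp only: mult_ac)
  then show ?thesis by (simp only: E S)
qed

lemma real_polynomial_function_ident: "real_polynomial_function (\<lambda>t. t)"
  by (rule real_polynomial_function.intros(1)) (rule bounded_linear_ident)

lemma real_polynomial_function_hermite_poly [intro]: "real_polynomial_function (hermite_poly n)"
proof -
  have "real_polynomial_function (\<lambda>t. hermite_poly n t) \<and> real_polynomial_function (\<lambda>t. hermite_poly (Suc n) t)"
    by (induction n)
       (auto intro!: real_polynomial_function.intros(2-) real_polynomial_function_diff real_polynomial_function_ident)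
  then show ?thesis by simp
qed

lemma hermite_poly_affine:
  "real_polynomial_function (\<lambda>t. hermite_poly n (a + b * t))"
proof -
  have "real_polynomial_function (\<lambda>t. a + b * t)"
    by (intro real_polynomial_function.intros(2-) real_polynomial_function_ident)
  then have "polynomial_function (\<lambda>t. a + b * t)"
    by (simp add: real_polynomial_function_eq)
  from real_polynomial_function_compose[OF this real_polynomial_function_hermite_poly[of n]]
  show ?thesis by (simp add: o_def)
qed

lemma real_polynomial_function_exp_bound:
  fixes p :: "real \<Rightarrow> real"
  assumes "real_polynomial_function p"
  shows "\<exists>C k. 0 \<le> k \<and> (\<forall>t. \<bar>p t\<bar> \<le> C * exp (k * \<bar>t\<bar>))"
  using assms
proof induction
  case (linear f)
  then obtain c where f: "f = (\<lambda>x. x * c)" using real_bounded_linear by blast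
  show ?case
  proof (intro exI conjI allI)
    fix t :: real
    have "\<bar>t\<bar> \<le> exp \<bar>t\<bar>" using exp_ge_add_one_self[of "\<bar>t\<bar>"] by linarith
    then show "\<bar>f t\<bar> \<le> \<bar>c\<bar> * exp (1 * \<bar>t\<bar>)" by (simp add: f abs_mult mult.commute mult_left_mono)
  qed simp
next
  case (const c)
  show ?case by (rule exI[of _ "\<bar>c\<bar>"], rule exI[of _ 0]) simp
next
  case (add f g)
  then obtain C k D l where *: "0 \<le> k" "\<And>t. \<bar>f t\<bar> \<le> C * exp (k * \<bar>t\<bar>)" "0 \<le> l" "\<And>t. \<bar>g t\<bar> \<le> D * exp (l * \<bar>t\<bar>)"
    by blast
  have "\<bar>f t + g t\<bar> \<le> (\<bar>C\<bar> + \<bar>D\<bar>) * exp ((k + l) * \<bar>t\<bar>)" for t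
  proof -
    have "C * exp (k * \<bar>t\<bar>) \<le> \<bar>C\<bar> * exp ((k + l) * \<bar>t\<bar>)" "D * exp (l * \<bar>t\<bar>) \<le> \<bar>D\<bar> * exp ((k + l) * \<bar>t\<bar>)"
      using * by (intro mult_mono; simp add: mult_right_mono)+
    then show ?thesis
      using *(2)[of t] *(4)[of t] distrib_right[of "\<bar>C\<bar>" "\<bar>D\<bar>" "exp ((k + l) * \<bar>t\<bar>)"] by linarith
  qed
  then show ?case using * by (intro exI[of _ "\<bar>C\<bar> + \<bar>D\<bar>"] exI[of _ "k + l"]) auto
next
  case (mult f g)
  then obtain C k D l where *: "0 \<le> k" "\<And>t. \<bar>f t\<bar> \<le> C * exp (k * \<bar>t\<bar>)" "0 \<le> l" "\<And>t. \<bar>g t\<bar> \<le> D * exp (l * \<bar>t\<bar>)"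
    by blast
  have "\<bar>f t * g t\<bar> \<le> (C * D) * exp ((k + l) * \<bar>t\<bar>)" for t
    using mult_mono'[OF *(2)[of t] *(4)[of t]] by (simp add: abs_mult ring_distribs exp_add mult_ac)
  then show ?case using * by (intro exI[of _ "C * D"] exI[of _ "k + l"]) auto
qed

text \<open>
  Completing the square.  Together with the exponential bound on polynomials it makes every
  polynomial times a Gaussian integrable and vanishing at infinity.
\<close>

lemma exp_linear_gaussian_bound:
  fixes a k t :: real
  assumes "0 < a"
  shows "exp (k * \<bar>t\<bar>) * exp (- a * t\<^sup>2) \<le> exp (k\<^sup>2 / (2 * a)) * exp (- (a / 2) * t\<^sup>2)"
proof -
  have "0 \<le> (k - a * \<bar>t\<bar>)\<^sup>2 / (2 * a)" using assms by simp
  also have "\<dots> = k\<^sup>2 / (2 * a) - k * \<bar>t\<bar> + a * t\<^sup>2 / 2"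
    using assms by (simp add: power2_eq_square field_simps)
  finally show ?thesis by (simp flip: exp_add)
qed

lemma polynomial_gaussian_bound:
  assumes "real_polynomial_function p" and "0 < a"
  shows "\<exists>C. \<forall>t. \<bar>p t\<bar> * exp (- a * t\<^sup>2) \<le> C * exp (- (a / 2) * t\<^sup>2)"
proof -
  obtain C k where *: "0 \<le> k" "\<And>t. \<bar>p t\<bar> \<le> C * exp (k * \<bar>t\<bar>)"
    using real_polynomial_function_exp_bound[OF assms(1)] by blast
  have C: "0 \<le> C" using *(2)[of 0] by simp
  have "\<bar>p t\<bar> * exp (- a * t\<^sup>2) \<le> C * exp (k\<^sup>2 / (2 * a)) * exp (- (a / 2) * t\<^sup>2)" for t
  proof -
    have "\<bar>p t\<bar> * exp (- a * t\<^sup>2) \<le> C * (exp (k * \<bar>t\<bar>) * exp (- a * t\<^sup>2))"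
      using mult_right_mono[OF *(2)[of t], of "exp (- a * t\<^sup>2)"] by (simp add: mult.assoc)
    also have "\<dots> \<le> C * (exp (k\<^sup>2 / (2 * a)) * exp (- (a / 2) * t\<^sup>2))"
      by (intro mult_left_mono exp_linear_gaussian_bound assms C)
    finally show ?thesis by (simp only: mult.assoc)
  qed
  then show ?thesis by blast
qed

text \<open>
  A Gaussian times a character: at \<open>a = 2 \<pi>\<close>, \<open>w = 0\<close> the weight of orthogonality for the Hermite
  polynomials, at \<open>a = \<pi> / 2\<close> the weight that remains in the Wigner integral of two Hermite functions.
\<close>

definition gauss_char :: "real \<Rightarrow> real \<Rightarrow> real \<Rightarrow> complex" where
  "gauss_char a w t = exp (- (of_real (a * t\<^sup>2)) - 2 * pi * \<i> * of_real (w * t))"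

lemma norm_gauss_char: "norm (gauss_char a w t) = exp (- a * t\<^sup>2)"
  by (simp add: gauss_char_def)

lemma has_vector_derivative_gauss_char:
  "(gauss_char a w has_vector_derivative - (2 * a * t + 2 * pi * \<i> * w) * gauss_char a w t) (at t)"
proof -
  have "((\<lambda>z. exp (- (of_real a * z\<^sup>2) - 2 * pi * \<i> * w * z)) has_field_derivative
      - (2 * a * t + 2 * pi * \<i> * w) * gauss_char a w t) (at (of_real t))"
    by (auto intro!: derivative_eq_intros simp: gauss_char_def algebra_simps)
  from has_vector_derivative_real_field[OF this] show ?thesis
    unfolding gauss_char_def[abs_def] by (simp add: mult.assoc)
qed

lemma continuous_gauss_char: "continuous_on A (gauss_char a w)"
  unfolding gauss_char_def by (intro continuous_intros)

text \<open>
  The Fourier transform of the standard normal distribution, after rescaling.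
\<close>

lemma gaussian_integral:
  assumes "0 < a"
  shows "integrable lborel (gauss_char a w)"
    and "(\<integral>t. gauss_char a w t \<partial>lborel) = of_real (sqrt (pi / a) * exp (- (pi * w)\<^sup>2 / a))"
proof -
  \<comment> \<open>With this scaling the Gaussian becomes the standard normal density up to a constant.\<close>
  define s where "s = 1 / sqrt (2 * a)"
  have s: "s > 0" "s\<^sup>2 = 1 / (2 * a)" using assms by (simp_all add: s_def power_divide)
  define h where "h x = iexp (- 2 * pi * w * s * x) * of_real (std_normal_density x)" for x
  have h_int: "integrable lborel h"
  proof (rule Bochner_Integration.integrable_bound[OF integrable_normal_density[of 1 0, OF zero_less_one]])
    show "h \<in> borel_measurable lborel" unfolding h_def by measurable
  qed (simp add: h_def norm_mult)
  have g: "gauss_char a w (0 + s * x) = of_real (sqrt (2 * pi)) * h x" for x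
  proof -
    have sq: "a * (0 + s * x)\<^sup>2 = x\<^sup>2 / 2" using assms by (simp add: power_mult_distrib s(2))
    have "gauss_char a w (0 + s * x) = exp (of_real (- x\<^sup>2 / 2) + \<i> * of_real (- 2 * pi * w * s * x))"
      unfolding gauss_char_def sq by (simp add: mult_ac)
    also have "\<dots> = of_real (exp (- x\<^sup>2 / 2)) * iexp (- 2 * pi * w * s * x)"
      by (simp only: exp_add exp_of_real)
    finally show ?thesis by (simp add: h_def std_normal_density_def)
  qed
  show 1: "integrable lborel (gauss_char a w)"
    using lborel_integrable_real_affine_iff[of s "gauss_char a w" 0] s h_int g by simp
  have "(\<integral>x. h x \<partial>lborel) = char std_normal_distribution (- 2 * pi * w * s)"
    unfolding char_def h_def
    by (subst integral_density) (auto simp: scaleR_conv_of_real mult_ac)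
  also have "\<dots> = of_real (exp (- (pi * w)\<^sup>2 / a))"
    unfolding char_std_normal_distribution using assms by (simp add: power_mult_distrib s(2) field_simps)
  finally have h: "(\<integral>x. h x \<partial>lborel) = of_real (exp (- (pi * w)\<^sup>2 / a))" .
  have "(\<integral>t. gauss_char a w t \<partial>lborel) = s * (of_real (sqrt (2 * pi)) * (\<integral>x. h x \<partial>lborel))"
    using s by (subst lborel_integral_real_affine[of s _ 0]) (simp_all only: g, simp add: scaleR_conv_of_real)
  also have "s * sqrt (2 * pi) = sqrt (pi / a)"
    by (simp add: s_def real_sqrt_divide real_sqrt_mult)
  then have "s * (of_real (sqrt (2 * pi)) * (\<integral>x. h x \<partial>lborel)) = of_real (sqrt (pi / a)) * (\<integral>x. h x \<partial>lborel)"
    by (metis mult.assoc of_real_mult)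
  finally show "(\<integral>t. gauss_char a w t \<partial>lborel) = of_real (sqrt (pi / a) * exp (- (pi * w)\<^sup>2 / a))"
    by (simp add: h)
qed

lemma integrable_exp_square: 
  assumes "0 < a" shows "integrable lborel (\<lambda>t::real. exp (- a * t\<^sup>2))"
  using integrable_norm[OF gaussian_integral(1)[OF assms, of 0]] by (simp add: norm_gauss_char)

lemma borel_measurable_real_polynomial_function:
  fixes p :: "real \<Rightarrow> real"
  assumes "real_polynomial_function p"
  shows "p \<in> borel_measurable borel"
  using continuous_real_polymonial_function[OF assms]
  by (intro borel_measurable_continuous_onI continuous_at_imp_continuous_on ballI)

lemma integrable_polynomial_gauss_char:
  assumes p: "real_polynomial_function p" and "0 < a"
  shows "integrable lborel (\<lambda>t. of_real (p t) * gauss_char a w t)"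
proof -
  obtain C where C: "\<And>t. \<bar>p t\<bar> * exp (- a * t\<^sup>2) \<le> C * exp (- (a / 2) * t\<^sup>2)"
    using polynomial_gaussian_bound[OF assms] by blast
  have [measurable]: "p \<in> borel_measurable borel" "gauss_char a w \<in> borel_measurable borel"
    by (rule borel_measurable_real_polynomial_function[OF p],
        rule borel_measurable_continuous_onI[OF continuous_gauss_char])
  have "integrable lborel (\<lambda>t. C * exp (- (a / 2) * t\<^sup>2))"
    using integrable_exp_square[of "a / 2"] \<open>0 < a\<close> by (intro integrable_mult_right) simp
  then show ?thesis
  proof (rule Bochner_Integration.integrable_bound)
    show "AE t in lborel. norm (of_real (p t) * gauss_char a w t) \<le> norm (C * exp (- (a / 2) * t\<^sup>2))"
      using order_trans[OF C abs_ge_self] by (intro AE_I2) (simp only: norm_mult norm_gauss_char norm_of_real real_norm_def)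
  qed measurable
qed

text \<open>
  The integral of the derivative of \<open>p\<close> times the weight is zero.  Multiplication by the linear
  factor is thereby exchanged for differentiation of \<open>p\<close>, which is the source of all recursions below.
\<close>

lemma gaussian_integration_by_parts:
  assumes p: "real_polynomial_function p" "real_polynomial_function p'" and "0 < a"
    and deriv: "\<And>t. (p has_real_derivative p' t) (at t)"
  shows "(\<integral>t. of_real (p t) * (2 * a * t + 2 * pi * \<i> * w) * gauss_char a w t \<partial>lborel)
       = (\<integral>t. of_real (p' t) * gauss_char a w t \<partial>lborel)"
proof -
  let ?F = "\<lambda>t. of_real (p t) * gauss_char a w t"
  let ?f = "\<lambda>t. of_real (p' t) * gauss_char a w t - of_real (p t) * (2 * a * t + 2 * pi * \<i> * w) * gauss_char a w t"
  have rt: "real_polynomial_function (\<lambda>t. p t * t)"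
    using p by (intro real_polynomial_function.intros(2-) real_polynomial_function_ident)
  have i1: "integrable lborel (\<lambda>t. of_real (p' t) * gauss_char a w t)"
    by (rule integrable_polynomial_gauss_char) fact+
  have i2: "integrable lborel (\<lambda>t. of_real (p t) * (2 * a * t + 2 * pi * \<i> * w) * gauss_char a w t)"
  proof -
    have "integrable lborel (\<lambda>t. 2 * a * (of_real (p t * t) * gauss_char a w t) + 2 * pi * \<i> * w * (of_real (p t) * gauss_char a w t))"
      using integrable_polynomial_gauss_char[OF rt \<open>0 < a\<close>] integrable_polynomial_gauss_char[OF p(1) \<open>0 < a\<close>]
      by (intro Bochner_Integration.integrable_add integrable_mult_right)
    then show ?thesis by (simp add: algebra_simps)
  qed
  have der: "(?F has_vector_derivative ?f t) (at t)" for t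
    using has_vector_derivative_mult[OF has_vector_derivative_of_real[OF deriv[of t]] has_vector_derivative_gauss_char[of a w t]]
    by (simp add: algebra_simps)
  have cont: "isCont ?f t" for t
  proof -
    have "continuous_on UNIV p" "continuous_on UNIV p'"
      using p[THEN continuous_real_polymonial_function] by (auto intro!: continuous_at_imp_continuous_on)
    then have "continuous_on UNIV ?f"
      by (intro continuous_intros continuous_gauss_char)
    then show ?thesis by (simp add: continuous_on_eq_continuous_at)
  qed
  obtain C where C: "\<And>t. \<bar>p t\<bar> * exp (- a * t\<^sup>2) \<le> C * exp (- (a / 2) * t\<^sup>2)"
    using polynomial_gaussian_bound[OF p(1) \<open>0 < a\<close>] by blast
  have L: "(?F \<longlongrightarrow> 0) at_top" "(?F \<longlongrightarrow> 0) at_bot"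
  proof -
    have e: "((\<lambda>t. C * exp (- (a / 2) * t\<^sup>2)) \<longlongrightarrow> 0) at_top" "((\<lambda>t. C * exp (- (a / 2) * t\<^sup>2)) \<longlongrightarrow> 0) at_bot"
      using \<open>0 < a\<close> by real_asymp+
    show "(?F \<longlongrightarrow> 0) at_top" "(?F \<longlongrightarrow> 0) at_bot"
      by (rule Lim_null_comparison[OF _ e(1)] Lim_null_comparison[OF _ e(2)];
          use C in \<open>simp add: norm_mult norm_gauss_char\<close>)+
  qed
  have "(LBINT t=-\<infinity>..\<infinity>. ?f t) = 0 - 0"
  proof (rule interval_integral_FTC_integrable)
    show "set_integrable lborel (einterval (- \<infinity>) \<infinity>) ?f"
      using i1 i2 by (simp add: set_integrable_def)
    show "((?F \<circ> real_of_ereal) \<longlongrightarrow> 0) (at_right (- \<infinity>))" "((?F \<circ> real_of_ereal) \<longlongrightarrow> 0) (at_left \<infinity>)"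
      using L by (simp_all add: ereal_tendsto_simps)
  qed (use der cont in auto)
  then have "(\<integral>t. ?f t \<partial>lborel) = 0"
    by (simp add: interval_integral_eq_integral' einterval_def set_lebesgue_integral_def interval_lebesgue_integral_def)
  then show ?thesis using i1 i2 by simp
qed

text \<open>
  Integration by parts moves one step of the recursion from \<open>n\<close> to \<open>m\<close>, giving
  \<open>J (n + 1) m = 4 \<pi> m J n (m - 1)\<close>; symmetry settles the case \<open>n = 0 < m\<close>.
\<close>

lemma hermite_poly_inner:
  "(\<integral>t. of_real (hermite_poly n t * hermite_poly m t) * gauss_char (2 * pi) 0 t \<partial>lborel)
     = (if n = m then of_real (fact n * (4 * pi) ^ n / sqrt 2) else 0)"
proof (induction n arbitrary: m)
  define J where "J n m = (\<integral>t. of_real (hermite_poly n t * hermite_poly m t) * gauss_char (2 * pi) 0 t \<partial>lborel)" for n m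
  have int: "integrable lborel (\<lambda>t. of_real (hermite_poly n t * hermite_poly m t) * gauss_char (2 * pi) 0 t)" for n m
    by (intro integrable_polynomial_gauss_char real_polynomial_function.intros real_polynomial_function_hermite_poly) auto
  have J_Suc: "J (Suc n) m = 4 * pi * m * J n (m - 1)" for n m
  proof -
    have "(\<integral>t. of_real (hermite_poly n t * hermite_poly m t) * (2 * complex_of_real (2 * pi) * t + 2 * pi * \<i> * of_real 0) * gauss_char (2 * pi) 0 t \<partial>lborel)
      = (\<integral>t. of_real (4 * pi * n * (hermite_poly (n - 1) t * hermite_poly m t) + 4 * pi * m * (hermite_poly n t * hermite_poly (m - 1) t)) * gauss_char (2 * pi) 0 t \<partial>lborel)"
      by (rule gaussian_integration_by_parts[of "\<lambda>t. hermite_poly n t * hermite_poly m t"])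
         (auto intro!: real_polynomial_function.intros(2-) derivative_eq_intros)
    also have "\<dots> = (\<integral>t. of_real (4 * pi * n) * (of_real (hermite_poly (n - 1) t * hermite_poly m t) * gauss_char (2 * pi) 0 t)
         + of_real (4 * pi * m) * (of_real (hermite_poly n t * hermite_poly (m - 1) t) * gauss_char (2 * pi) 0 t) \<partial>lborel)"
      by (simp add: algebra_simps)
    also have "\<dots> = of_real (4 * pi * n) * J (n - 1) m + of_real (4 * pi * m) * J n (m - 1)"
      unfolding J_def by (subst Bochner_Integration.integral_add) (auto intro!: integrable_mult_right int simp del: of_real_mult)
    finally have 1: "(\<integral>t. of_real (hermite_poly n t * hermite_poly m t) * (2 * complex_of_real (2 * pi) * t + 2 * pi * \<i> * of_real 0) * gauss_char (2 * pi) 0 t \<partial>lborel) = \<dots>" .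
    have "(\<integral>t. of_real (hermite_poly n t * hermite_poly m t) * (2 * complex_of_real (2 * pi) * t + 2 * pi * \<i> * of_real 0) * gauss_char (2 * pi) 0 t \<partial>lborel)
       = (\<integral>t. of_real (hermite_poly (Suc n) t * hermite_poly m t) * gauss_char (2 * pi) 0 t
           + of_real (4 * pi * n) * (of_real (hermite_poly (n - 1) t * hermite_poly m t) * gauss_char (2 * pi) 0 t) \<partial>lborel)"
      by (rule Bochner_Integration.integral_cong) (simp_all add: hermite_poly_Suc algebra_simps)
    also have "\<dots> = J (Suc n) m + of_real (4 * pi * n) * J (n - 1) m"
      unfolding J_def by (subst Bochner_Integration.integral_add) (auto intro!: integrable_mult_right int simp del: of_real_mult)
    finally show ?thesis using 1 by simp
  qed
  have J00: "J 0 0 = of_real (1 / sqrt 2)"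
    unfolding J_def using gaussian_integral(2)[of "2 * pi" 0] by (simp add: real_sqrt_divide)
  have J_sym: "J n m = J m n" for n m unfolding J_def by (simp add: mult.commute)
  {
    case 0
    show ?case
    proof (cases m)
      case (Suc k)
      then have "J 0 m = 0" using J_Suc[of k 0] J_sym[of 0 m] by simp
      then show ?thesis using Suc unfolding J_def by simp
    qed (use J00 in \<open>simp add: J_def\<close>)
  next
    case (Suc n)
    show ?case
      unfolding J_def[symmetric] J_Suc using Suc[folded J_def, of "m - 1"]
      by (cases m) (auto simp: field_simps)
  }
qed

section \<open>Wigner distributions of one-dimensional Hermite functions\<close>

text \<open>
  The Wigner integral of two Hermite functions without normalisation and without the factor
  \<open>exp(-2 \<pi> x\<^sup>2)\<close>, which comes out of the integral because
  \<open>(x + t / 2)\<^sup>2 + (x - t / 2)\<^sup>2 = 2 x\<^sup>2 + t\<^sup>2 / 2\<close>.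
\<close>

definition wigner_poly :: "nat \<Rightarrow> nat \<Rightarrow> real \<Rightarrow> real \<Rightarrow> complex" where
  "wigner_poly n m x w = (\<integral>t. of_real (hermite_poly n (x + t / 2) * hermite_poly m (x - t / 2)) * gauss_char (pi / 2) w t \<partial>lborel)"

lemma wigner_poly_integrable:
  "integrable lborel (\<lambda>t. of_real (hermite_poly n (x + t / 2) * hermite_poly m (x - t / 2)) * gauss_char (pi / 2) w t)"
  using hermite_poly_affine[of n x "1/2"] hermite_poly_affine[of m x "-1/2"]
  by (intro integrable_polynomial_gauss_char real_polynomial_function.intros(2-)) auto

lemma wigner_poly_by_parts:
  "(\<integral>t. of_real (hermite_poly n (x + t / 2) * hermite_poly m (x - t / 2)) * (pi * t + 2 * pi * \<i> * w) * gauss_char (pi / 2) w t \<partial>lborel)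
     = 2 * pi * n * wigner_poly (n - 1) m x w - 2 * pi * m * wigner_poly n (m - 1) x w"
proof -
  note rp = hermite_poly_affine[of _ x "1/2", simplified] hermite_poly_affine[of _ x "-1/2", simplified]
  have "(\<integral>t. of_real (hermite_poly n (x + t / 2) * hermite_poly m (x - t / 2)) * (2 * complex_of_real (pi / 2) * t + 2 * pi * \<i> * w) * gauss_char (pi / 2) w t \<partial>lborel)
     = (\<integral>t. of_real (2 * pi * n * (hermite_poly (n - 1) (x + t / 2) * hermite_poly m (x - t / 2))
                    - 2 * pi * m * (hermite_poly n (x + t / 2) * hermite_poly (m - 1) (x - t / 2))) * gauss_char (pi / 2) w t \<partial>lborel)"
    by (rule gaussian_integration_by_parts[of "\<lambda>t. hermite_poly n (x + t / 2) * hermite_poly m (x - t / 2)"])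
       (auto intro!: real_polynomial_function.intros(2-) real_polynomial_function_diff rp derivative_eq_intros)
  also have "\<dots> = (\<integral>t. of_real (2 * pi * n) * (of_real (hermite_poly (n - 1) (x + t / 2) * hermite_poly m (x - t / 2)) * gauss_char (pi / 2) w t)
                    - of_real (2 * pi * m) * (of_real (hermite_poly n (x + t / 2) * hermite_poly (m - 1) (x - t / 2)) * gauss_char (pi / 2) w t) \<partial>lborel)"
    by (simp add: algebra_simps)
  also have "\<dots> = of_real (2 * pi * n) * wigner_poly (n - 1) m x w - of_real (2 * pi * m) * wigner_poly n (m - 1) x w"
    unfolding wigner_poly_def
    by (subst Bochner_Integration.integral_diff) (auto intro!: integrable_mult_right wigner_poly_integrable simp del: of_real_mult)
  finally show ?thesis by simp
qed

lemma wigner_poly_by_parts_integrable: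
  "integrable lborel (\<lambda>t. of_real (hermite_poly n (x + t / 2) * hermite_poly m (x - t / 2)) * (pi * t + 2 * pi * \<i> * w) * gauss_char (pi / 2) w t)"
proof -
  have "integrable lborel (\<lambda>t. pi * (of_real (hermite_poly n (x + t / 2) * hermite_poly m (x - t / 2) * t) * gauss_char (pi / 2) w t)
      + 2 * pi * \<i> * w * (of_real (hermite_poly n (x + t / 2) * hermite_poly m (x - t / 2)) * gauss_char (pi / 2) w t))"
    using hermite_poly_affine[of n x "1/2"] hermite_poly_affine[of m x "-1/2"]
    by (intro integrable_polynomial_gauss_char real_polynomial_function.intros(2-) real_polynomial_function_ident
          Bochner_Integration.integrable_add integrable_mult_right) auto
  then show ?thesis by (simp add: algebra_simps)
qed

text \<open>
  The three-term recursion for \<open>H\<^sub>n\<^sub>+\<^sub>1 (x + t / 2)\<close> contains the factor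
  \<open>4 \<pi> (x + t / 2) = 4 \<pi> (x - i w) + 2 (\<pi> t + 2 \<pi> i w)\<close>, whose second part is integrated by parts.  The
  resulting term with \<open>n - 1\<close> cancels the one in the recursion.
\<close>

lemma wigner_poly_Suc_left:
  "wigner_poly (Suc n) m x w
     = 4 * pi * (x - \<i> * w) * wigner_poly n m x w - 4 * pi * m * wigner_poly n (m - 1) x w"
proof -
  let ?g = "\<lambda>n m t. of_real (hermite_poly n (x + t / 2) * hermite_poly m (x - t / 2)) * gauss_char (pi / 2) w t"
  let ?h = "\<lambda>t. of_real (hermite_poly n (x + t / 2) * hermite_poly m (x - t / 2)) * (pi * t + 2 * pi * \<i> * w) * gauss_char (pi / 2) w t"
  have "?g (Suc n) m = (\<lambda>t. 4 * pi * (x - \<i> * w) * ?g n m t + 2 * ?h t - 4 * pi * n * ?g (n - 1) m t)"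
    by (rule ext) (simp add: hermite_poly_Suc algebra_simps)
  then have "wigner_poly (Suc n) m x w = (\<integral>t. 4 * pi * (x - \<i> * w) * ?g n m t + 2 * ?h t - 4 * pi * n * ?g (n - 1) m t \<partial>lborel)"
    unfolding wigner_poly_def by simp
  also have "\<dots> = 4 * pi * (x - \<i> * w) * (\<integral>t. ?g n m t \<partial>lborel) + 2 * (\<integral>t. ?h t \<partial>lborel) - 4 * pi * n * (\<integral>t. ?g (n - 1) m t \<partial>lborel)"
    by (subst Bochner_Integration.integral_diff Bochner_Integration.integral_add;
        (intro Bochner_Integration.integrable_add integrable_mult_right wigner_poly_integrable wigner_poly_by_parts_integrable)?)+
       (simp only: integral_mult_right_zero)
  finally show ?thesis unfolding wigner_poly_by_parts wigner_poly_def[symmetric] by (simp add: algebra_simps)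
qed

text \<open>
  The mirror image, with \<open>4 \<pi> (x - t / 2) = 4 \<pi> (x + i w) - 2 (\<pi> t + 2 \<pi> i w)\<close>.
\<close>

lemma wigner_poly_Suc_right:
  "wigner_poly n (Suc m) x w
     = 4 * pi * (x + \<i> * w) * wigner_poly n m x w - 4 * pi * n * wigner_poly (n - 1) m x w"
proof -
  let ?g = "\<lambda>n m t. of_real (hermite_poly n (x + t / 2) * hermite_poly m (x - t / 2)) * gauss_char (pi / 2) w t"
  let ?h = "\<lambda>t. of_real (hermite_poly n (x + t / 2) * hermite_poly m (x - t / 2)) * (pi * t + 2 * pi * \<i> * w) * gauss_char (pi / 2) w t"
  have "?g n (Suc m) = (\<lambda>t. 4 * pi * (x + \<i> * w) * ?g n m t - 2 * ?h t - 4 * pi * m * ?g n (m - 1) t)"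
    by (rule ext) (simp add: hermite_poly_Suc algebra_simps)
  then have "wigner_poly n (Suc m) x w = (\<integral>t. 4 * pi * (x + \<i> * w) * ?g n m t - 2 * ?h t - 4 * pi * m * ?g n (m - 1) t \<partial>lborel)"
    unfolding wigner_poly_def by simp
  also have "\<dots> = 4 * pi * (x + \<i> * w) * (\<integral>t. ?g n m t \<partial>lborel) - 2 * (\<integral>t. ?h t \<partial>lborel) - 4 * pi * m * (\<integral>t. ?g n (m - 1) t \<partial>lborel)"
    by (subst Bochner_Integration.integral_diff;
        (intro Bochner_Integration.integrable_diff integrable_mult_right wigner_poly_integrable wigner_poly_by_parts_integrable)?)+
       (simp only: integral_mult_right_zero)
  finally show ?thesis unfolding wigner_poly_by_parts wigner_poly_def[symmetric] by (simp add: algebra_simps)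
qed

text \<open>
  The complex (Ito) Hermite polynomials, up to scaling, in two variables \<open>a\<close> and \<open>b\<close>, later specialised to conjugate
  arguments; the recursion is the one for \<open>wigner_poly\<close>.
\<close>

primrec complex_hermite :: "nat \<Rightarrow> nat \<Rightarrow> complex \<Rightarrow> complex \<Rightarrow> complex" where
  "complex_hermite 0 m a b = b ^ m"
| "complex_hermite (Suc n) m a b = a * complex_hermite n m a b - 4 * pi * m * complex_hermite n (m - 1) a b"

lemma wigner_poly_eq:
  "wigner_poly n m x w
     = of_real (sqrt 2 * exp (- 2 * pi * w\<^sup>2)) * complex_hermite n m (4 * pi * (x - \<i> * w)) (4 * pi * (x + \<i> * w))"
proof (induction n arbitrary: m)
  case 0
  show ?case
  proof (induction m)
    case 0
    have "(pi * w)\<^sup>2 / (pi / 2) = 2 * pi * w\<^sup>2" by (simp add: power2_eq_square)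
    then show ?case
      using gaussian_integral(2)[of "pi / 2" w] unfolding wigner_poly_def by simp
  qed (simp add: wigner_poly_Suc_right)
next
  case (Suc n)
  show ?case unfolding wigner_poly_Suc_left Suc complex_hermite.simps
    by (simp add: algebra_simps)
qed

text \<open>
  Every monomial \<open>a\<^sup>k b\<^sup>l\<close> of the polynomial satisfies \<open>k - l = n - m\<close>.  With
  \<open>u = exp(-i \<theta>)\<close> and \<open>v = exp(i \<theta>)\<close> this becomes the behaviour under rotations.
\<close>

lemma complex_hermite_covariant:
  assumes "u * v = 1"
  shows "complex_hermite n m (u * a) (v * b) = u ^ n * v ^ m * complex_hermite n m a b"
proof (induction n arbitrary: m)
  case (Suc n)
  show ?case
  proof (cases m)
    case 0
    then show ?thesis using Suc[of 0] by simp
  next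
    case (Suc k)
    have "u ^ Suc n * v ^ Suc k = (u * v) * (u ^ n * v ^ k)" by (simp add: mult_ac)
    then have "u ^ n * v ^ k = u ^ Suc n * v ^ Suc k" using assms by simp
    then have e: "u ^ n * v ^ k * z = u ^ Suc n * v ^ Suc k * z" for z by simp
    show ?thesis
      unfolding Suc complex_hermite.simps Suc.IH diff_Suc_1 e by (simp add: algebra_simps)
  qed
qed (simp add: power_mult_distrib)

text \<open>
  Induction on \<open>n\<close> through Pascal's rule: the summands with \<open>n choose k\<close> come from the term with
  \<open>m - 1\<close>, by \<open>m (m - 1 choose k) = (k + 1) (m choose k + 1)\<close>, the others from multiplication by \<open>a\<close>.
\<close>

lemma complex_hermite_sum:
  "complex_hermite n m a b
     = (\<Sum>k\<le>n. (- 4 * complex_of_real pi) ^ k * fact k * of_nat (n choose k) * of_nat (m choose k) * a ^ (n - k) * b ^ (m - k))"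
proof (induction n arbitrary: m)
  case (Suc n)
  define T :: "nat \<Rightarrow> nat \<Rightarrow> nat \<Rightarrow> complex" where "T n m k = (- 4 * complex_of_real pi) ^ k * fact k * of_nat (n choose k) * of_nat (m choose k) * a ^ (n - k) * b ^ (m - k)" for n m k :: nat
  define U :: "nat \<Rightarrow> complex" where "U k = (- 4 * complex_of_real pi) ^ Suc k * fact (Suc k) * of_nat (n choose k) * of_nat (m choose Suc k) * a ^ (n - k) * b ^ (m - Suc k)" for k
  define V :: "nat \<Rightarrow> complex" where "V k = (- 4 * complex_of_real pi) ^ Suc k * fact (Suc k) * of_nat (n choose Suc k) * of_nat (m choose Suc k) * a ^ (n - k) * b ^ (m - Suc k)" for k
  have U: "- (4 * pi * m) * T n (m - 1) k = U k" for k
  proof (cases m)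
    case (Suc l)
    have "of_nat (Suc l) * of_nat (l choose k) = (of_nat (Suc k) * of_nat (Suc l choose Suc k) :: complex)"
      using Suc_times_binomial[of k l] by (metis of_nat_mult)
    then show ?thesis unfolding T_def U_def Suc diff_Suc_1 by (simp add: fact_Suc mult_ac del: of_nat_Suc binomial_Suc_Suc)
  qed (simp add: U_def)
  have V: "a * T n m (Suc k) = V k" if "k < n" for k
  proof -
    have "n - k = Suc (n - Suc k)" using that by simp
    then show ?thesis unfolding T_def V_def by (simp add: mult_ac)
  qed
  have "(\<Sum>k\<le>Suc n. T (Suc n) m k) = T (Suc n) m 0 + (\<Sum>k\<le>n. T (Suc n) m (Suc k))"
    by (rule sum.atMost_Suc_shift)
  also have "(\<Sum>k\<le>n. T (Suc n) m (Suc k)) = (\<Sum>k\<le>n. U k) + (\<Sum>k\<le>n. V k)"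
    unfolding sum.distrib[symmetric] T_def U_def V_def by (rule sum.cong) (simp_all add: algebra_simps)
  also have "(\<Sum>k\<le>n. V k) = (\<Sum>k<n. V k)"
    by (simp add: V_def flip: lessThan_Suc_atMost)
  also have "\<dots> = (\<Sum>k<n. a * T n m (Suc k))" by (simp add: V)
  also have "T (Suc n) m 0 + ((\<Sum>k\<le>n. U k) + (\<Sum>k<n. a * T n m (Suc k)))
      = a * (T n m 0 + (\<Sum>k<n. T n m (Suc k))) + (\<Sum>k\<le>n. U k)"
    by (simp add: sum_distrib_left algebra_simps T_def)
  also have "T n m 0 + (\<Sum>k<n. T n m (Suc k)) = (\<Sum>k\<le>n. T n m k)"
    using sum.lessThan_Suc_shift[of "T n m" n] unfolding lessThan_Suc_atMost by simp
  also have "(\<Sum>k\<le>n. U k) = - (4 * pi * m) * (\<Sum>k\<le>n. T n (m - 1) k)"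
    by (simp only: U[symmetric] sum_distrib_left)
  finally show ?case
    using Suc[of m] Suc[of "m - 1"] by (simp add: T_def)
qed simp

lemma complex_hermite_diagonal_summand:
  fixes c X F B :: complex
  assumes "j \<le> n" and FB: "F * B = fact n / fact j"
  shows "(- c) ^ (n - j) * F * B * B * (c * X) ^ j = (- c) ^ n * fact n * ((-1) ^ j * B * X ^ j / fact j)"
proof -
  have 1: "(- c) ^ (n - j) * (- c) ^ j = (- c) ^ n" using assms by (simp flip: power_add)
  have 2: "(c * X) ^ j = (- c) ^ j * ((-1) ^ j * X ^ j)" by (simp flip: power_mult_distrib)
  have "(- c) ^ (n - j) * F * B * B * (c * X) ^ j
      = ((- c) ^ (n - j) * (- c) ^ j) * (F * B) * B * ((-1) ^ j * X ^ j)"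
    unfolding 2 by (simp only: mult_ac)
  then show ?thesis unfolding 1 FB by simp
qed

text \<open>
  Reversing the order of summation and using \<open>(n - j)! (n choose n - j) = n! / j!\<close> once turns the sum
  into the Laguerre polynomial.
\<close>

lemma complex_hermite_diagonal:
  fixes a b :: complex
  assumes "a * b = of_real ((4 * pi)\<^sup>2 * \<rho>)"
  shows "complex_hermite n n a b = (- 4 * complex_of_real pi) ^ n * fact n * of_real (laguerre n (4 * pi * \<rho>))"
proof -
  define c :: complex where "c = 4 * of_real pi"
  define X :: complex where "X = of_real (4 * pi * \<rho>)"
  have ab: "a * b = c * X" by (simp add: assms c_def X_def power2_eq_square)
  have c': "- 4 * complex_of_real pi = - c" by (simp add: c_def)
  have "complex_hermite n n a b
      = (\<Sum>k\<le>n. (- c) ^ k * fact k * of_nat (n choose k) * of_nat (n choose k) * (a * b) ^ (n - k))"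
    unfolding complex_hermite_sum c' by (simp only: power_mult_distrib mult_ac)
  also have "\<dots> = (\<Sum>j\<le>n. (- c) ^ (n - j) * fact (n - j) * of_nat (n choose (n - j)) * of_nat (n choose (n - j)) * (c * X) ^ j)"
    unfolding ab by (rule sum.reindex_bij_witness[where i="\<lambda>j. n - j" and j="\<lambda>j. n - j"]) auto
  also have "\<dots> = (\<Sum>j\<le>n. (- c) ^ n * fact n * ((-1) ^ j * of_nat (n choose (n - j)) * X ^ j / fact j))"
  proof (rule sum.cong[OF refl])
    fix j assume "j \<in> {..n}"
    then have j: "j \<le> n" by simp
    have "fact j * fact (n - j) * of_nat (n choose j) = (fact n :: complex)"
      by (metis binomial_fact_lemma j of_nat_fact of_nat_mult)
    then have "fact (n - j) * of_nat (n choose (n - j)) = (fact n / fact j :: complex)"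
      using j by (simp add: field_simps binomial_symmetric[symmetric])
    with j show "(- c) ^ (n - j) * fact (n - j) * of_nat (n choose (n - j)) * of_nat (n choose (n - j)) * (c * X) ^ j
        = (- c) ^ n * fact n * ((-1) ^ j * of_nat (n choose (n - j)) * X ^ j / fact j)"
      by (rule complex_hermite_diagonal_summand)
  qed
  also have "\<dots> = (- c) ^ n * fact n * of_real (laguerre n (4 * pi * \<rho>))"
    by (simp add: laguerre_def atLeast0AtMost sum_distrib_left X_def)
  finally show ?thesis unfolding c' .
qed

section \<open>Hermite functions in several variables\<close>

definition hermite_coeff :: "nat \<Rightarrow> real" where
  "hermite_coeff n = 2 powr (1/4) / sqrt (fact n) * (1 / (2 * sqrt pi)) ^ n"

lemma hermite_fun1_eq_coeff: "hermite_fun1 n t = hermite_coeff n * hermite_poly n t * exp (- pi * t\<^sup>2)"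
  by (simp add: hermite_fun1_eq hermite_coeff_def)

lemma hermite_coeff_pos: "hermite_coeff n > 0"
  by (simp add: hermite_coeff_def)

lemma hermite_coeff_sq: "(hermite_coeff n)\<^sup>2 = sqrt 2 / (fact n * (4 * pi) ^ n)"
proof -
  have "(2 powr (1/4))\<^sup>2 = (sqrt 2 :: real)"
    by (simp add: power2_eq_square powr_half_sqrt flip: powr_add)
  moreover have "((1 / (2 * sqrt pi)) ^ n)\<^sup>2 = 1 / (4 * pi) ^ n"
    by (simp add: power_mult[symmetric] mult.commute[of n] power_divide power_mult_distrib power_mult)
  ultimately show ?thesis
    by (simp add: hermite_coeff_def power_mult_distrib power_divide)
qed

lemma continuous_hermite_fun1 [continuous_intros]:
  "continuous_on A f \<Longrightarrow> continuous_on A (\<lambda>x. hermite_fun1 n (f x))"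
proof -
  have "continuous_on UNIV (\<lambda>t. hermite_fun1 n t)"
    unfolding hermite_fun1_eq
    by (intro continuous_intros continuous_at_imp_continuous_on ballI
          continuous_real_polymonial_function real_polynomial_function_hermite_poly) 
  then show "continuous_on A f \<Longrightarrow> continuous_on A (\<lambda>x. hermite_fun1 n (f x))"
    using continuous_on_compose2 by blast
qed

lemma borel_measurable_hermite_fun1 [measurable]: "hermite_fun1 n \<in> borel_measurable borel"
  by (intro borel_measurable_continuous_onI continuous_intros)

lemma hermite_fun1_orthonormal:
  "integrable lborel (\<lambda>t. hermite_fun1 n t * hermite_fun1 m t)"
  "(\<integral>t. hermite_fun1 n t * hermite_fun1 m t \<partial>lborel) = (if n = m then 1 else 0)"
proof -
  have e: "complex_of_real (hermite_fun1 n t * hermite_fun1 m t)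
      = of_real (hermite_coeff n * hermite_coeff m) * (of_real (hermite_poly n t * hermite_poly m t) * gauss_char (2 * pi) 0 t)" for t
  proof -
    have "exp (- pi * t\<^sup>2) * exp (- pi * t\<^sup>2) = exp (- (2 * pi * t\<^sup>2))" by (simp flip: exp_add)
    moreover have "gauss_char (2 * pi) 0 t = of_real (exp (- (2 * pi * t\<^sup>2)))"
      unfolding gauss_char_def exp_of_real[symmetric] by simp
    ultimately show ?thesis
      by (simp add: hermite_fun1_eq_coeff mult_ac flip: of_real_mult)
  qed
  have i: "integrable lborel (\<lambda>t. of_real (hermite_poly n t * hermite_poly m t) * gauss_char (2 * pi) 0 t)"
    by (intro integrable_polynomial_gauss_char real_polynomial_function.intros(2-) real_polynomial_function_hermite_poly) auto
  then have "integrable lborel (\<lambda>t. complex_of_real (hermite_fun1 n t * hermite_fun1 m t))"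
    unfolding e by (rule integrable_mult_right)
  then show "integrable lborel (\<lambda>t. hermite_fun1 n t * hermite_fun1 m t)"
    by (subst (asm) complex_of_real_integrable_eq)
  have "complex_of_real (\<integral>t. hermite_fun1 n t * hermite_fun1 m t \<partial>lborel)
      = (\<integral>t. complex_of_real (hermite_fun1 n t * hermite_fun1 m t) \<partial>lborel)"
    by (rule integral_complex_of_real[symmetric])
  also have "\<dots> = of_real (hermite_coeff n * hermite_coeff m) * (if n = m then of_real (fact n * (4 * pi) ^ n / sqrt 2) else 0)"
    unfolding e by (simp add: hermite_poly_inner del: of_real_mult)
  also have "\<dots> = (if n = m then of_real ((hermite_coeff n)\<^sup>2 * (fact n * (4 * pi) ^ n / sqrt 2)) else 0)"
    by (simp add: power2_eq_square)
  also have "\<dots> = of_real (if n = m then 1 else 0)"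
    by (simp add: hermite_coeff_sq)
  finally show "(\<integral>t. hermite_fun1 n t * hermite_fun1 m t \<partial>lborel) = (if n = m then 1 else 0)"
    by (simp only: of_real_eq_iff)
qed

lemma borel_measurable_hermite_fun [measurable]: "hermite_fun n \<in> borel_measurable borel"
  unfolding hermite_fun_def by measurable

lemma hermite_fun_in_L2: "hermite_fun n \<in> L2"
proof -
  have "integrable lborel (\<lambda>t. \<Prod>j\<in>UNIV. hermite_fun1 (n $ j) (t $ j) * hermite_fun1 (n $ j) (t $ j))"
    by (intro integrable_prod_cart hermite_fun1_orthonormal)
  moreover have "(cmod (hermite_fun n t))\<^sup>2 = (\<Prod>j\<in>UNIV. hermite_fun1 (n $ j) (t $ j) * hermite_fun1 (n $ j) (t $ j))" for t
    unfolding hermite_fun_def norm_of_real by (simp add: power2_eq_square prod.distrib)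
  ultimately show ?thesis
    by (simp add: L2_def)
qed

lemma hermite_fun_orthonormal:
  fixes n m :: "nat^'d::finite"
  shows "L2_inner (hermite_fun n) (hermite_fun m) = (if n = m then 1 else 0)"
proof -
  have "L2_inner (hermite_fun n) (hermite_fun m)
      = (\<integral>t. complex_of_real (\<Prod>j\<in>UNIV. hermite_fun1 (n $ j) (t $ j) * hermite_fun1 (m $ j) (t $ j)) \<partial>lborel)"
    unfolding L2_inner_def hermite_fun_def by (simp add: prod.distrib)
  also have "\<dots> = of_real (\<integral>t. (\<Prod>j\<in>UNIV. hermite_fun1 (n $ j) (t $ j) * hermite_fun1 (m $ j) (t $ j)) \<partial>lborel)"
    by (rule integral_complex_of_real)
  also have "(\<integral>t. (\<Prod>j\<in>UNIV. hermite_fun1 (n $ j) (t $ j) * hermite_fun1 (m $ j) (t $ j)) \<partial>lborel)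
      = (\<Prod>j\<in>UNIV. \<integral>s. hermite_fun1 (n $ j) s * hermite_fun1 (m $ j) s \<partial>lborel)"
    by (rule integrable_prod_cart) (rule hermite_fun1_orthonormal)
  also have "\<dots> = (if n = m then 1 else 0)"
    by (auto simp: hermite_fun1_orthonormal vec_eq_iff)
  finally show ?thesis by simp
qed

text \<open>
  The closed form of the Wigner distribution of \<open>\<phi>\<^sub>n\<close> and \<open>\<phi>\<^sub>m\<close> in one dimension.
\<close>

definition hermite_wigner1 :: "nat \<Rightarrow> nat \<Rightarrow> real \<times> real \<Rightarrow> complex" where
  "hermite_wigner1 n m z = of_real (sqrt 2 * hermite_coeff n * hermite_coeff m * exp (- 2 * pi * (norm z)\<^sup>2))
     * complex_hermite n m (4 * pi * (of_real (fst z) - \<i> * of_real (snd z))) (4 * pi * (of_real (fst z) + \<i> * of_real (snd z)))"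

lemma hermite_wigner1_integral:
  fixes x w :: real and n m :: nat
  defines "h \<equiv> (\<lambda>t. complex_of_real (hermite_fun1 n (x + t / 2) * hermite_fun1 m (x - t / 2)) * exp (- 2 * pi * \<i> * of_real (w * t)))"
  shows "integrable lborel h" and "(\<integral>t. h t \<partial>lborel) = hermite_wigner1 n m (x, w)"
proof -
  have h: "h t = of_real (hermite_coeff n * hermite_coeff m * exp (- 2 * pi * x\<^sup>2)) *
      (of_real (hermite_poly n (x + t / 2) * hermite_poly m (x - t / 2)) * gauss_char (pi / 2) w t)" for t
  proof -
    have "exp (- pi * (x + t / 2)\<^sup>2) * exp (- pi * (x - t / 2)\<^sup>2) = exp (- 2 * pi * x\<^sup>2) * exp (- (pi / 2 * t\<^sup>2))"
      unfolding exp_add[symmetric] by (simp add: power2_eq_square algebra_simps)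
    moreover have "gauss_char (pi / 2) w t = of_real (exp (- (pi / 2 * t\<^sup>2))) * exp (- 2 * pi * \<i> * of_real (w * t))"
      unfolding gauss_char_def exp_of_real[symmetric] exp_add[symmetric] by simp
    moreover have "h t = of_real (hermite_coeff n * hermite_coeff m * (hermite_poly n (x + t / 2) * hermite_poly m (x - t / 2))
       * (exp (- pi * (x + t / 2)\<^sup>2) * exp (- pi * (x - t / 2)\<^sup>2))) * exp (- 2 * pi * \<i> * of_real (w * t))"
      unfolding h_def hermite_fun1_eq_coeff by (simp only: mult_ac)
    ultimately show ?thesis by (simp only: of_real_mult mult_ac)
  qed
  show "integrable lborel h"
    unfolding h by (intro integrable_mult_right wigner_poly_integrable)
  have "(\<integral>t. h t \<partial>lborel) = of_real (hermite_coeff n * hermite_coeff m * exp (- 2 * pi * x\<^sup>2)) * wigner_poly n m x w"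
    unfolding h wigner_poly_def by (rule integral_mult_right_zero)
  moreover have "exp (- 2 * pi * (norm (x, w))\<^sup>2) = exp (- 2 * pi * x\<^sup>2) * exp (- 2 * pi * w\<^sup>2)"
    unfolding exp_add[symmetric] by (simp add: norm_Pair algebra_simps)
  ultimately show "(\<integral>t. h t \<partial>lborel) = hermite_wigner1 n m (x, w)"
    unfolding wigner_poly_eq hermite_wigner1_def by (simp add: mult_ac)
qed

lemma wigner_hermite_fun:
  "wigner (hermite_fun n) (hermite_fun m) z
     = (\<Prod>j\<in>UNIV. hermite_wigner1 (n $ j) (m $ j) (fst z $ j, snd z $ j))"
proof (cases z)
  case (Pair x w)
  have "wigner (hermite_fun n) (hermite_fun m) (x, w)
      = (\<integral>t. (\<Prod>j\<in>UNIV. of_real (hermite_fun1 (n $ j) (x $ j + t $ j / 2) * hermite_fun1 (m $ j) (x $ j - t $ j / 2))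
            * exp (- 2 * pi * \<i> * of_real (w $ j * t $ j))) \<partial>lborel)"
    unfolding wigner_def prod.case hermite_fun_def inner_vec_def
    by (simp add: prod.distrib sum_distrib_left exp_sum flip: sum_negf)
  also have "\<dots> = (\<Prod>j\<in>UNIV. \<integral>t. of_real (hermite_fun1 (n $ j) (x $ j + t / 2) * hermite_fun1 (m $ j) (x $ j - t / 2))
            * exp (- 2 * pi * \<i> * of_real (w $ j * t)) \<partial>lborel)"
    by (rule integrable_prod_cart) (rule hermite_wigner1_integral)
  also have "\<dots> = (\<Prod>j\<in>UNIV. hermite_wigner1 (n $ j) (m $ j) (x $ j, w $ j))"
    by (simp only: hermite_wigner1_integral)
  finally show ?thesis by (simp add: Pair)
qed

lemma hermite_wigner1_rotate:
  "hermite_wigner1 n m (rotate \<theta> z) = cis (real m * \<theta> - real n * \<theta>) * hermite_wigner1 n m z"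
proof -
  have 1: "of_real (fst (rotate \<theta> z)) - \<i> * of_real (snd (rotate \<theta> z)) = cis (- \<theta>) * (of_real (fst z) - \<i> * of_real (snd z))"
    "of_real (fst (rotate \<theta> z)) + \<i> * of_real (snd (rotate \<theta> z)) = cis \<theta> * (of_real (fst z) + \<i> * of_real (snd z))"
    by (auto simp: rotate_def case_prod_beta complex_eq_iff cis.simps algebra_simps)
  have cov: "complex_hermite n m (cis (- \<theta>) * (4 * pi * (of_real (fst z) - \<i> * of_real (snd z)))) (cis \<theta> * (4 * pi * (of_real (fst z) + \<i> * of_real (snd z))))
     = cis (- \<theta>) ^ n * cis \<theta> ^ m * complex_hermite n m (4 * pi * (of_real (fst z) - \<i> * of_real (snd z))) (4 * pi * (of_real (fst z) + \<i> * of_real (snd z)))"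
    by (rule complex_hermite_covariant) (simp add: cis_mult)
  have ph: "cis (- \<theta>) ^ n * cis \<theta> ^ m = cis (real m * \<theta> - real n * \<theta>)"
    by (simp only: Complex.DeMoivre cis_mult mult_minus_right uminus_add_conv_diff)
  show ?thesis
    using cov[unfolded ph] unfolding hermite_wigner1_def norm_rotate 1 by (simp only: mult_ac)
qed

lemma hermite_wigner1_diagonal:
  "hermite_wigner1 n n z = of_real (2 * (-1) ^ n * exp (- 2 * pi * (norm z)\<^sup>2) * laguerre n (4 * pi * (norm z)\<^sup>2))"
proof -
  have H: "complex_hermite n n (4 * pi * (of_real (fst z) - \<i> * of_real (snd z))) (4 * pi * (of_real (fst z) + \<i> * of_real (snd z)))
      = (- 4 * complex_of_real pi) ^ n * fact n * of_real (laguerre n (4 * pi * (norm z)\<^sup>2))"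
    by (rule complex_hermite_diagonal)
       (cases z, simp add: norm_Pair power2_eq_square complex_eq_iff algebra_simps)
  have c: "sqrt 2 * hermite_coeff n * hermite_coeff n * ((- 4 * pi) ^ n * fact n) = 2 * (-1) ^ n"
  proof -
    have "(- 4 * pi) ^ n = (-1) ^ n * (4 * pi) ^ n"
      using power_mult_distrib[of "-1" "4 * pi" n] by simp
    moreover have "sqrt 2 * hermite_coeff n * hermite_coeff n = 2 / (fact n * (4 * pi) ^ n)"
      using hermite_coeff_sq[of n] by (simp add: power2_eq_square mult.assoc)
    ultimately show ?thesis by simp
  qed
  have C: "complex_of_real (sqrt 2 * hermite_coeff n * hermite_coeff n) * ((- 4 * complex_of_real pi) ^ n * fact n) = of_real (2 * (-1) ^ n)"
    using arg_cong[OF c, of complex_of_real]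
    by (simp only: of_real_fact of_real_minus of_real_mult of_real_numeral of_real_power)
  have "hermite_wigner1 n n z
      = complex_of_real (sqrt 2 * hermite_coeff n * hermite_coeff n) * ((- 4 * complex_of_real pi) ^ n * fact n)
        * of_real (exp (- 2 * pi * (norm z)\<^sup>2)) * of_real (laguerre n (4 * pi * (norm z)\<^sup>2))"
    unfolding hermite_wigner1_def H by (simp only: of_real_mult mult_ac)
  then show ?thesis unfolding C by (simp only: of_real_mult)
qed

lemma continuous_hermite_wigner1: "continuous_on A (hermite_wigner1 n m)"
proof -
  have K: "continuous_on A (\<lambda>z::real \<times> real. complex_hermite n m (f z) (g z))"
    if "continuous_on A f" "continuous_on A g" for f g
    using that by (induction n arbitrary: m) (auto intro!: continuous_intros)
  show ?thesis
    unfolding hermite_wigner1_def by (intro continuous_intros K)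
qed

section \<open>Integrals of Wigner distributions over polyradial sets\<close>

lemma wigner_hermite_fun_measurable [measurable]:
  "wigner (hermite_fun n) (hermite_fun m) \<in> borel_measurable borel"
proof -
  have "continuous_on UNIV (\<lambda>z. \<Prod>j\<in>UNIV. hermite_wigner1 (n $ j) (m $ j) (fst z $ j, snd z $ j))"
    by (intro continuous_on_prod continuous_on_compose2[OF continuous_hermite_wigner1[of UNIV]] continuous_intros) auto
  then show ?thesis
    by (subst wigner_hermite_fun[abs_def]) (rule borel_measurable_continuous_onI)
qed

text \<open>
  Rotating a plane \<open>j\<close> with \<open>n\<^sub>j \<noteq> m\<^sub>j\<close> by \<open>\<theta> = \<pi> / (2 (m\<^sub>j - n\<^sub>j))\<close> preserves moduli and measure but
  multiplies the integrand by \<open>exp(i (m\<^sub>j - n\<^sub>j) \<theta>) = i\<close>, so the integral \<open>I\<close> satisfies \<open>I = i I\<close>.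
  The angle is at most a quarter turn, hence within the range of the shear decomposition.
\<close>

lemma integral_wigner_hermite_off_diagonal:
  fixes n m :: "nat^'d::finite" and W :: "(real^'d) set"
  assumes [measurable]: "W \<in> sets borel" and "n \<noteq> m"
  shows "(\<integral>z. indicator W (radii z) * wigner (hermite_fun n) (hermite_fun m) z \<partial>lborel) = 0"
proof -
  define G where "G z = indicator W (radii z) * wigner (hermite_fun n) (hermite_fun m) z" for z
  have [measurable]: "G \<in> borel_measurable borel" unfolding G_def by measurable
  obtain j where j: "n $ j \<noteq> m $ j" using \<open>n \<noteq> m\<close> by (auto simp: vec_eq_iff)
  define k where "k = real (m $ j) - real (n $ j)"
  have "\<bar>int (m $ j) - int (n $ j)\<bar> \<ge> 1" using j by linarith
  then have "\<bar>k\<bar> \<ge> 1" unfolding k_def by linarith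
  then have k: "k \<noteq> 0" "\<bar>k\<bar> \<ge> 1" by auto
  define \<theta> where "\<theta> = pi / (2 * k)"
  have "\<bar>\<theta>\<bar> \<le> pi / 2" using k by (simp add: \<theta>_def abs_mult divide_simps)
  then have "0 \<le> cos \<theta>" by (intro cos_ge_zero) auto
  then have cos: "cos \<theta> \<noteq> -1" by linarith
  have ph: "cis (real (m $ j) * \<theta> - real (n $ j) * \<theta>) = \<i>"
  proof -
    have "real (m $ j) * \<theta> - real (n $ j) * \<theta> = k * \<theta>" by (simp add: k_def algebra_simps)
    also have "\<dots> = pi / 2" using k by (simp add: \<theta>_def)
    finally have e: "real (m $ j) * \<theta> - real (n $ j) * \<theta> = pi / 2" .
    show ?thesis unfolding e by simp
  qed
  define T where "T i = (if i = j then rotate \<theta> else id)" for i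
  have T_meas: "T i \<in> measurable lborel lborel" for i by (auto simp: T_def measurable_rotate)
  have "distr lborel lborel (rotate \<theta>) = lborel" "distr lborel lborel (id :: real \<times> real \<Rightarrow> _) = lborel"
    using distr_lborel_rotate[OF cos] by (simp_all add: distr_id2 cong: distr_cong)
  then have T_distr: "distr (PiM UNIV (\<lambda>_. lborel)) (PiM UNIV (\<lambda>_. lborel)) (\<lambda>f i. T i (f i)) = PiM UNIV (\<lambda>_::'d. lborel)"
    by (intro distr_PiM_componentwise sigma_finite_lborel T_meas) (simp add: T_def)
  have T_meas': "(\<lambda>f i. T i (f i)) \<in> measurable (PiM UNIV (\<lambda>_::'d. lborel)) (PiM UNIV (\<lambda>_. lborel))"
  proof (rule measurable_PiM_single')
    show "(\<lambda>f. T i (f i)) \<in> measurable (PiM UNIV (\<lambda>_::'d. lborel)) lborel" for i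
      by (rule measurable_compose[OF measurable_component_singleton[of i UNIV "\<lambda>_. lborel"] T_meas]) simp
  qed (simp add: space_PiM)
  have G_T: "G (to_phase (\<lambda>i. T i (f i))) = \<i> * G (to_phase f)" for f
  proof -
    have "radii (to_phase (\<lambda>i. T i (f i))) = radii (to_phase f)"
      by (simp add: radii_to_phase T_def vec_eq_iff)
    moreover have "wigner (hermite_fun n) (hermite_fun m) (to_phase (\<lambda>i. T i (f i)))
        = \<i> * wigner (hermite_fun n) (hermite_fun m) (to_phase f)"
    proof -
      have "hermite_wigner1 (n $ i) (m $ i) (T i (f i)) = (if i = j then \<i> else 1) * hermite_wigner1 (n $ i) (m $ i) (f i)" for i
        by (simp add: T_def hermite_wigner1_rotate ph)
      then show ?thesis
        by (simp add: wigner_hermite_fun to_phase_def prod.distrib)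
    qed
    ultimately show ?thesis by (simp add: G_def)
  qed
  have e1: "(\<integral>z. G z \<partial>lborel) = (\<integral>f. G (to_phase f) \<partial>PiM UNIV (\<lambda>_::'d. lborel))"
    unfolding lborel_phase_eq_PiM by (rule integral_distr) measurable
  have e2: "(\<integral>f. G (to_phase f) \<partial>PiM UNIV (\<lambda>_::'d. lborel)) = (\<integral>f. \<i> * G (to_phase f) \<partial>PiM UNIV (\<lambda>_::'d. lborel))"
    by (subst T_distr[symmetric], subst integral_distr[OF T_meas']) (simp_all add: G_T)
  have "(\<integral>z. G z \<partial>lborel) = \<i> * (\<integral>z. G z \<partial>lborel)"
    unfolding e1 by (rule trans[OF e2 integral_mult_right_zero])
  then have "(\<integral>z. G z \<partial>lborel) * (1 - \<i>) = 0" by (simp add: algebra_simps)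
  then show ?thesis unfolding G_def by (simp add: complex_eq_iff)
qed

lemma borel_measurable_laguerre [measurable]: "laguerre n \<in> borel_measurable borel"
  unfolding laguerre_def[abs_def] by (intro borel_measurable_continuous_onI continuous_intros) simp_all

lemma integral_wigner_hermite_diagonal:
  fixes n :: "nat^'d::finite" and W :: "(real^'d) set"
  assumes [measurable]: "W \<in> sets borel" and pos: "\<And>r i. r \<in> W \<Longrightarrow> 0 \<le> r $ i"
  shows "(\<integral>z. indicator W (radii z) * wigner (hermite_fun n) (hermite_fun n) z \<partial>lborel)
     = of_real ((4 * pi) ^ CARD('d) * (- 1) ^ (\<Sum>j\<in>UNIV. n $ j)
         * (LINT r:W|lborel. (\<Prod>j\<in>UNIV. exp (- 2 * pi * (r $ j)\<^sup>2) * laguerre (n $ j) (4 * pi * (r $ j)\<^sup>2) * r $ j)))"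
proof -
  define H :: "real^'d \<Rightarrow> real" where
    "H r = indicator W r * (\<Prod>j\<in>UNIV. 2 * (-1) ^ (n $ j) * exp (- 2 * pi * (r $ j)\<^sup>2) * laguerre (n $ j) (4 * pi * (r $ j)\<^sup>2))" for r
  have [measurable]: "H \<in> borel_measurable borel" unfolding H_def by measurable
  have 1: "indicator W (radii z) * wigner (hermite_fun n) (hermite_fun n) z = of_real (H (radii z))" for z
    by (simp add: H_def wigner_hermite_fun hermite_wigner1_diagonal radii_def indicator_def)
  have 2: "(\<Prod>i\<in>UNIV. 2 * pi * r $ i * indicator {0..} (r $ i)) * H r
      = (4 * pi) ^ CARD('d) * (- 1) ^ (\<Sum>j\<in>UNIV. n $ j)
        * (indicator W r *\<^sub>R (\<Prod>j\<in>UNIV. exp (- 2 * pi * (r $ j)\<^sup>2) * laguerre (n $ j) (4 * pi * (r $ j)\<^sup>2) * r $ j))" for r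
  proof (cases "r \<in> W")
    case True
    have "H r = (\<Prod>j\<in>UNIV. 2 * (-1) ^ (n $ j) * exp (- 2 * pi * (r $ j)\<^sup>2) * laguerre (n $ j) (4 * pi * (r $ j)\<^sup>2))"
      using True by (simp add: H_def)
    moreover have "indicator {0..} (r $ i) = (1 :: real)" for i
      using pos[OF True] by simp
    ultimately have "(\<Prod>i\<in>UNIV. 2 * pi * r $ i * indicator {0..} (r $ i)) * H r
        = (\<Prod>j\<in>UNIV. 2 * pi * r $ j * 1 * (2 * (-1) ^ (n $ j) * exp (- 2 * pi * (r $ j)\<^sup>2) * laguerre (n $ j) (4 * pi * (r $ j)\<^sup>2)))"
      by (simp only: prod.distrib)
    also have "\<dots> = (\<Prod>j\<in>UNIV. (4 * pi) * (-1) ^ (n $ j) * (exp (- 2 * pi * (r $ j)\<^sup>2) * laguerre (n $ j) (4 * pi * (r $ j)\<^sup>2) * r $ j))"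
      by (rule prod.cong) simp_all
    also have "\<dots> = (4 * pi) ^ CARD('d) * (- 1) ^ (\<Sum>j\<in>UNIV. n $ j)
        * (\<Prod>j\<in>UNIV. exp (- 2 * pi * (r $ j)\<^sup>2) * laguerre (n $ j) (4 * pi * (r $ j)\<^sup>2) * r $ j)"
      unfolding prod.distrib by (simp add: power_sum)
    finally show ?thesis using True by simp
  qed (simp add: H_def)
  have "(\<integral>z. indicator W (radii z) * wigner (hermite_fun n) (hermite_fun n) z \<partial>lborel)
      = of_real (\<integral>z. H (radii z) \<partial>lborel)"
    unfolding 1 by (rule integral_complex_of_real)
  also have "(\<integral>z. H (radii z) \<partial>lborel) = (\<integral>r. (\<Prod>i\<in>UNIV. 2 * pi * r $ i * indicator {0..} (r $ i)) * H r \<partial>lborel)"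
    by (rule integral_polyradial) measurable
  also have "\<dots> = (4 * pi) ^ CARD('d) * (- 1) ^ (\<Sum>j\<in>UNIV. n $ j)
         * (LINT r:W|lborel. (\<Prod>j\<in>UNIV. exp (- 2 * pi * (r $ j)\<^sup>2) * laguerre (n $ j) (4 * pi * (r $ j)\<^sup>2) * r $ j))"
    unfolding 2 set_lebesgue_integral_def by (rule integral_mult_right_zero)
  finally show ?thesis .
qed

section \<open>Completeness of the Hermite functions\<close>

lemma L2_borel_measurable [measurable_dest]: "f \<in> L2 \<Longrightarrow> f \<in> borel_measurable borel"
  by (simp add: L2_def)

lemma L2I_bounded:
  fixes f :: "'a::euclidean_space \<Rightarrow> complex"
  assumes [measurable]: "f \<in> borel_measurable borel"
    and "\<And>x. (cmod (f x))\<^sup>2 \<le> G x" and "integrable lborel G"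
  shows "f \<in> L2"
proof -
  have "integrable lborel (\<lambda>x. (cmod (f x))\<^sup>2)"
    by (rule Bochner_Integration.integrable_bound[OF assms(3)])
       (use order_trans[OF assms(2) abs_ge_self] in auto)
  then show ?thesis by (simp add: L2_def)
qed

lemma L2_mult_integrable:
  assumes f: "f \<in> L2" and g: "g \<in> L2"
  shows "integrable lborel (\<lambda>x. f x * g x)"
proof (rule Bochner_Integration.integrable_bound)
  show "integrable lborel (\<lambda>x. (cmod (f x))\<^sup>2 + (cmod (g x))\<^sup>2)"
    using f g by (intro Bochner_Integration.integrable_add) (auto simp: L2_def)
  have "cmod (f x) * cmod (g x) \<le> (cmod (f x))\<^sup>2 + (cmod (g x))\<^sup>2" for x
  proof -
    have "2 * (cmod (f x) * cmod (g x)) \<le> (cmod (f x))\<^sup>2 + (cmod (g x))\<^sup>2" "0 \<le> cmod (f x) * cmod (g x)"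
      using sum_squares_bound[of "cmod (f x)" "cmod (g x)"] by (simp_all add: mult.assoc)
    then show ?thesis by linarith
  qed
  then show "AE x in lborel. norm (f x * g x) \<le> norm ((cmod (f x))\<^sup>2 + (cmod (g x))\<^sup>2)"
    by (auto simp: norm_mult)
  show "(\<lambda>x. f x * g x) \<in> borel_measurable lborel"
    using f g by measurable
qed

lemma L2_add:
  assumes f: "f \<in> L2" and g: "g \<in> L2"
  shows "(\<lambda>x. f x + g x) \<in> L2"
proof (rule L2I_bounded)
  show "integrable lborel (\<lambda>x. 2 * (cmod (f x))\<^sup>2 + 2 * (cmod (g x))\<^sup>2)"
    using f g by (auto simp: L2_def)
  show "(cmod (f x + g x))\<^sup>2 \<le> 2 * (cmod (f x))\<^sup>2 + 2 * (cmod (g x))\<^sup>2" for x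
  proof -
    have "(cmod (f x + g x))\<^sup>2 \<le> (cmod (f x) + cmod (g x))\<^sup>2"
      by (intro power_mono norm_triangle_ineq) simp
    also have "\<dots> \<le> 2 * (cmod (f x))\<^sup>2 + 2 * (cmod (g x))\<^sup>2"
      using sum_squares_bound[of "cmod (f x)" "cmod (g x)"] by (simp add: power2_sum)
    finally show ?thesis .
  qed
qed (use f g in measurable)

lemma L2_scale: "f \<in> L2 \<Longrightarrow> (\<lambda>x. c * f x) \<in> L2"
  unfolding L2_def by (auto simp: norm_mult power_mult_distrib)

lemma L2_prod_cart:
  fixes g :: "'d::finite \<Rightarrow> real \<Rightarrow> complex"
  assumes "\<And>j. g j \<in> L2"
  shows "(\<lambda>t::real^'d. \<Prod>j\<in>UNIV. g j (t $ j)) \<in> L2"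
proof -
  have [measurable]: "g j \<in> borel_measurable borel" for j using assms[of j] by measurable
  have "integrable lborel (\<lambda>t::real^'d. \<Prod>j\<in>UNIV. (cmod (g j (t $ j)))\<^sup>2)"
    by (rule integrable_prod_cart) (use assms in \<open>simp add: L2_def\<close>)
  then show ?thesis by (simp add: L2_def prod_norm[symmetric] prod_power_distrib)
qed

text \<open>
  An \<open>L\<^sup>2\<close>-type closure of the Hermite functions in which limits are pointwise and dominated by one square
  integrable function.  Convergence in this form is easy to verify for explicit
  sequences and passes through integrals against any \<open>f\<close> in \<open>L\<^sup>2\<close>.
\<close>

inductive_set hermite_closure :: "(real \<Rightarrow> complex) set" where
  hermite: "(\<lambda>t. of_real (hermite_fun1 n t)) \<in> hermite_closure"
| add: "f \<in> hermite_closure \<Longrightarrow> g \<in> hermite_closure \<Longrightarrow> (\<lambda>t. f t + g t) \<in> hermite_closure"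
| scale: "f \<in> hermite_closure \<Longrightarrow> (\<lambda>t. c * f t) \<in> hermite_closure"
| limit: "(\<And>k::nat. F k \<in> hermite_closure) \<Longrightarrow> (\<And>t. (\<lambda>k. F k t) \<longlonglongrightarrow> g t)
    \<Longrightarrow> (\<And>k t. cmod (F k t) \<le> G t) \<Longrightarrow> G \<in> borel_measurable borel
    \<Longrightarrow> integrable lborel (\<lambda>t. (G t)\<^sup>2) \<Longrightarrow> g \<in> hermite_closure"

lemma hermite_closure_L2: "f \<in> hermite_closure \<Longrightarrow> f \<in> L2"
proof (induction rule: hermite_closure.induct)
  case (hermite n)
  show ?case
    using hermite_fun1_orthonormal(1)[of n n] by (simp add: L2_def power2_eq_square)
next
  case (limit F g G)
  have G: "(cmod (F k t))\<^sup>2 \<le> (G t)\<^sup>2" for k t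
    by (intro power_mono limit) simp
  have l: "(\<lambda>k. (cmod (F k t))\<^sup>2) \<longlonglongrightarrow> (cmod (g t))\<^sup>2" for t
    by (intro tendsto_intros limit)
  have "(cmod (g t))\<^sup>2 \<le> (G t)\<^sup>2" for t
    using LIMSEQ_le_const2[OF l] G by blast
  moreover have "g \<in> borel_measurable borel"
    by (rule borel_measurable_LIMSEQ_metric[of F]) (use limit in \<open>auto intro: L2_borel_measurable\<close>)
  ultimately show ?case using limit by (intro L2I_bounded)
qed (auto intro: L2_add L2_scale)

text \<open>
  The Hermite functions in the factors are exchanged for arbitrary members of the closure, one
  coordinate at a time (induction on the set \<open>J\<close> of exchanged coordinates).  For the coordinate under
  exchange, the integral is linear in its factor and continuous under dominated
  limits, so the induction over the closure applies.
\<close>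

lemma hermite_closure_annihilated:
  fixes f :: "real^'d::finite \<Rightarrow> complex"
  assumes f: "f \<in> L2" and orth: "\<And>n. L2_inner f (hermite_fun n) = 0"
    and g: "\<And>j. g j \<in> hermite_closure"
  shows "(\<integral>t. f t * (\<Prod>j\<in>UNIV. g j (t $ j)) \<partial>lborel) = 0"
proof -
  have "finite J \<Longrightarrow> (\<forall>j\<in>J. g j \<in> hermite_closure) \<Longrightarrow> (\<forall>j. j \<notin> J \<longrightarrow> (\<exists>n. g j = (\<lambda>t. of_real (hermite_fun1 n t))))
     \<Longrightarrow> (\<integral>t. f t * (\<Prod>j\<in>UNIV. g j (t $ j)) \<partial>lborel) = 0" for J g
  proof (induction J arbitrary: g rule: finite_induct)
    case empty
    then have "\<forall>j. \<exists>n. g j = (\<lambda>t. of_real (hermite_fun1 n t))" by simp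
    from choice[OF this] obtain n where n: "\<forall>j. g j = (\<lambda>t. of_real (hermite_fun1 (n j) t))" by blast
    show ?case using orth[of "vec_lambda n"] by (simp add: n L2_inner_def hermite_fun_def)
  next
    case (insert k J)
    have gL2: "g j \<in> L2" for j
      using insert.prems hermite_closure_L2 hermite_closure.hermite by (cases "j \<in> insert k J") metis+
    define r where "r t = (\<Prod>j\<in>UNIV - {k}. g j (t $ j))" for t :: "real^'d"
    \<comment> \<open>The factor in the coordinate under exchange is separated from the others, which stay fixed.\<close>
    have split: "(\<Prod>j\<in>UNIV. (g(k := h)) j (t $ j)) = h (t $ k) * r t" for h and t :: "real^'d"
      unfolding r_def by (subst prod.remove[of _ k]) auto
    have prodL2: "(\<lambda>t::real^'d. h (t $ k) * r t) \<in> L2" if "h \<in> L2" for h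
    proof -
      have "(g(k := h)) j \<in> L2" for j using gL2 that by simp
      from L2_prod_cart[where g="g(k := h)", OF this] show ?thesis by (simp only: split)
    qed
    have int: "integrable lborel (\<lambda>t. f t * (h (t $ k) * r t))" if "h \<in> L2" for h
      by (intro L2_mult_integrable f prodL2 that)
    have r_meas [measurable]: "r \<in> borel_measurable borel"
    proof -
      have [measurable]: "g j \<in> borel_measurable borel" for j using gL2[of j] by measurable
      show ?thesis unfolding r_def[abs_def] by measurable
    qed
    have [measurable]: "f \<in> borel_measurable borel" using f by measurable
    have "(\<integral>t. f t * (h (t $ k) * r t) \<partial>lborel) = 0" if "h \<in> hermite_closure" for h
      using that
    proof (induction rule: hermite_closure.induct)
      case (hermite n)
      have "(\<integral>t. f t * (\<Prod>j\<in>UNIV. (g(k := \<lambda>t. of_real (hermite_fun1 n t))) j (t $ j)) \<partial>lborel) = 0"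
        by (rule insert.IH) (use insert in auto)
      then show ?case by (simp only: split)
    next
      case (add h h')
      show ?case
        using add int[OF hermite_closure_L2] by (simp add: ring_distribs)
    next
      case (scale h c)
      have "(\<integral>t. f t * (c * h (t $ k) * r t) \<partial>lborel) = (\<integral>t. c * (f t * (h (t $ k) * r t)) \<partial>lborel)"
        by (simp only: mult_ac)
      then show ?case using scale by (simp only: integral_mult_right_zero mult_zero_right)
    next
      case (limit F h G)
      note [measurable] = limit.hyps(4)
      have [measurable]: "F m \<in> borel_measurable borel" for m
        using hermite_closure_L2[OF limit.hyps(1)] by measurable
      have [measurable]: "h \<in> borel_measurable borel"
        by (rule borel_measurable_LIMSEQ_metric[of F]) (use limit in auto)
      have G: "(\<lambda>t. complex_of_real (G t)) \<in> L2"
        using limit by (simp add: L2_def)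
      have G0: "0 \<le> G t" for t 
        using order_trans[OF norm_ge_zero limit.hyps(3)] .
      have "(\<lambda>m. \<integral>t. f t * (F m (t $ k) * r t) \<partial>lborel) \<longlonglongrightarrow> (\<integral>t. f t * (h (t $ k) * r t) \<partial>lborel)"
      proof (rule integral_dominated_convergence)
        show "integrable lborel (\<lambda>t. cmod (f t * (complex_of_real (G (t $ k)) * r t)))"
          using int[OF G] by (rule integrable_norm)
        show "AE t in lborel. cmod (f t * (F m (t $ k) * r t)) \<le> cmod (f t * (complex_of_real (G (t $ k)) * r t))" for m
          using limit.hyps(3) G0 by (auto simp: norm_mult intro!: mult_left_mono mult_right_mono)
        show "AE t in lborel. (\<lambda>m. f t * (F m (t $ k) * r t)) \<longlonglongrightarrow> f t * (h (t $ k) * r t)"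
          by (intro AE_I2 tendsto_intros limit)
      qed measurable
      then show ?case using limit.IH by (simp add: LIMSEQ_const_iff)
    qed
    from this[of "g k"] show ?case
      using insert.prems split[of "g k"] by simp
  qed
  from this[of UNIV g] show ?thesis using g by simp
qed

lemma hermite_closure_sum:
  assumes "finite I" and "\<And>i. i \<in> I \<Longrightarrow> f i \<in> hermite_closure"
  shows "(\<lambda>t. \<Sum>i\<in>I. f i t) \<in> hermite_closure"
  using assms
proof (induction I rule: finite_induct)
  case empty
  then show ?case using hermite_closure.scale[OF hermite_closure.hermite, of 0] by simp
qed (auto intro: hermite_closure.add)

text \<open>
  The three-term recursion read backwards: multiplication by \<open>t\<close> stays within the span of the Hermite
  functions, so monomials times the Gaussian \<open>\<phi>\<^sub>0\<close> are obtained without discussing degrees.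
\<close>

lemma hermite_fun1_mult_arg:
  "t * hermite_fun1 n t = hermite_coeff n / (4 * pi * hermite_coeff (Suc n)) * hermite_fun1 (Suc n) t
     + real n * hermite_coeff n / hermite_coeff (n - 1) * hermite_fun1 (n - 1) t"
  using hermite_coeff_pos[of n] hermite_coeff_pos[of "Suc n"] hermite_coeff_pos[of "n - 1"]
  by (simp add: hermite_fun1_eq_coeff hermite_poly_Suc field_simps)

lemma power_mult_hermite_fun1_closure:
  "(\<lambda>t. of_real (t ^ k * hermite_fun1 n t)) \<in> hermite_closure"
proof (induction k arbitrary: n)
  case 0
  show ?case using hermite_closure.hermite by simp
next
  case (Suc k)
  have "(\<lambda>t. complex_of_real (t ^ Suc k * hermite_fun1 n t))
     = (\<lambda>t. of_real (hermite_coeff n / (4 * pi * hermite_coeff (Suc n))) * of_real (t ^ k * hermite_fun1 (Suc n) t)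
         + of_real (real n * hermite_coeff n / hermite_coeff (n - 1)) * of_real (t ^ k * hermite_fun1 (n - 1) t))"
  proof
    fix t
    have "t ^ Suc k * hermite_fun1 n t = t ^ k * (t * hermite_fun1 n t)" by simp
    also have "\<dots> = hermite_coeff n / (4 * pi * hermite_coeff (Suc n)) * (t ^ k * hermite_fun1 (Suc n) t)
         + real n * hermite_coeff n / hermite_coeff (n - 1) * (t ^ k * hermite_fun1 (n - 1) t)"
      unfolding hermite_fun1_mult_arg by (simp only: ring_distribs mult_ac)
    finally show "complex_of_real (t ^ Suc k * hermite_fun1 n t) = of_real (hermite_coeff n / (4 * pi * hermite_coeff (Suc n))) * of_real (t ^ k * hermite_fun1 (Suc n) t)
         + of_real (real n * hermite_coeff n / hermite_coeff (n - 1)) * of_real (t ^ k * hermite_fun1 (n - 1) t)"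
      by (simp only: of_real_add of_real_mult)
  qed
  then show ?case by (simp only:) (intro hermite_closure.add hermite_closure.scale Suc)
qed

lemma monomial_gaussian_closure:
  "(\<lambda>t. of_real (t ^ k * exp (- pi * t\<^sup>2))) \<in> hermite_closure"
proof -
  have "complex_of_real (t ^ k * exp (- pi * t\<^sup>2)) = of_real (1 / hermite_coeff 0) * of_real (t ^ k * hermite_fun1 0 t)" for t
    using hermite_coeff_pos[of 0] by (simp add: hermite_fun1_eq_coeff)
  then show ?thesis
    by (simp only:) (intro hermite_closure.scale power_mult_hermite_fun1_closure)
qed

lemma integrable_exp_linear_gaussian_square:
  "integrable lborel (\<lambda>t::real. (C * (exp (c * \<bar>t\<bar>) * exp (- pi * t\<^sup>2)))\<^sup>2)"
proof (rule Bochner_Integration.integrable_bound)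
  show "integrable lborel (\<lambda>t::real. C\<^sup>2 * (exp ((2 * c)\<^sup>2 / (2 * (2 * pi))) * exp (- (2 * pi / 2) * t\<^sup>2)))"
    using integrable_exp_square[of "2 * pi / 2"] by (intro integrable_mult_right) simp
  show "AE t in lborel. norm ((C * (exp (c * \<bar>t\<bar>) * exp (- pi * t\<^sup>2)))\<^sup>2)
      \<le> norm (C\<^sup>2 * (exp ((2 * c)\<^sup>2 / (2 * (2 * pi))) * exp (- (2 * pi / 2) * t\<^sup>2)))"
  proof (intro AE_I2)
    fix t :: real
    have "(exp (c * \<bar>t\<bar>) * exp (- pi * t\<^sup>2))\<^sup>2 = exp (2 * c * \<bar>t\<bar>) * exp (- (2 * pi) * t\<^sup>2)"
      unfolding exp_add[symmetric] exp_double[symmetric] by (simp add: algebra_simps)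
    also have "\<dots> \<le> exp ((2 * c)\<^sup>2 / (2 * (2 * pi))) * exp (- (2 * pi / 2) * t\<^sup>2)"
      by (rule exp_linear_gaussian_bound) simp
    finally have "C\<^sup>2 * (exp (c * \<bar>t\<bar>) * exp (- pi * t\<^sup>2))\<^sup>2 \<le> C\<^sup>2 * (exp ((2 * c)\<^sup>2 / (2 * (2 * pi))) * exp (- (2 * pi / 2) * t\<^sup>2))"
      by (rule mult_left_mono) simp
    then show "norm ((C * (exp (c * \<bar>t\<bar>) * exp (- pi * t\<^sup>2)))\<^sup>2)
      \<le> norm (C\<^sup>2 * (exp ((2 * c)\<^sup>2 / (2 * (2 * pi))) * exp (- (2 * pi / 2) * t\<^sup>2)))"
      by (simp only: power_mult_distrib real_norm_def abs_mult abs_power2 abs_exp_cancel) 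
  qed
qed measurable

text \<open>
  The exponential series, whose partial sums are dominated by \<open>exp(|z t|)\<close>; against the Gaussian this
  is still square integrable.
\<close>

lemma exp_gaussian_closure:
  fixes z :: real
  shows "(\<lambda>t. exp (\<i> * z * t) * of_real (exp (- pi * t\<^sup>2))) \<in> hermite_closure"
proof (rule hermite_closure.limit)
  let ?F = "\<lambda>N t. \<Sum>k<N. ((\<i> * z) ^ k / fact k) * complex_of_real (t ^ k * exp (- pi * t\<^sup>2))"
  let ?G = "\<lambda>t. 1 * (exp (\<bar>z\<bar> * \<bar>t\<bar>) * exp (- pi * t\<^sup>2))"
  show "?F N \<in> hermite_closure" for N
    by (intro hermite_closure_sum hermite_closure.scale monomial_gaussian_closure) simp
  have F: "?F N t = (\<Sum>k<N. (\<i> * z * t) ^ k /\<^sub>R fact k) * of_real (exp (- pi * t\<^sup>2))" for N t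
    unfolding sum_distrib_right
    by (rule sum.cong) (simp_all add: power_mult_distrib scaleR_conv_of_real field_simps)
  have "(\<lambda>N. \<Sum>k<N. (\<i> * z * t) ^ k /\<^sub>R fact k) \<longlonglongrightarrow> exp (\<i> * z * t)" for t :: real
    using exp_converges[of "\<i> * z * t"] by (simp add: sums_def)
  then show "(\<lambda>N. ?F N t) \<longlonglongrightarrow> exp (\<i> * z * t) * of_real (exp (- pi * t\<^sup>2))" for t
    unfolding F by (intro tendsto_intros)
  show "cmod (?F N t) \<le> ?G t" for N t
  proof -
    have "cmod (\<Sum>k<N. (\<i> * z * t) ^ k /\<^sub>R fact k) \<le> (\<Sum>k<N. (\<bar>z\<bar> * \<bar>t\<bar>) ^ k /\<^sub>R fact k)"
      by (rule sum_norm_le) (simp add: norm_mult norm_power)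
    also have "\<dots> \<le> (\<Sum>k. (\<bar>z\<bar> * \<bar>t\<bar>) ^ k /\<^sub>R fact k)"
      by (intro sum_le_suminf summable_exp_generic) auto
    also have "\<dots> = exp (\<bar>z\<bar> * \<bar>t\<bar>)" by (simp add: exp_def)
    finally show ?thesis unfolding F by (simp add: norm_mult)
  qed
  show "integrable lborel (\<lambda>t. (?G t)\<^sup>2)" by (rule integrable_exp_linear_gaussian_square)
qed measurable

lemma integrable_gaussian_square: "integrable lborel (\<lambda>t::real. (C * exp (- pi * t\<^sup>2))\<^sup>2)"
  using integrable_exp_linear_gaussian_square[of C 0] by simp

text \<open>
  Euler's formula writes one factor of the cosine as two frequency shifts, which is why the exponential
  with arbitrary frequency \<open>z\<close> is carried along.
\<close>

lemma cos_power_gaussian_closure: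
  fixes s t0 z :: real
  shows "(\<lambda>t. of_real (cos (s * (t - t0)) ^ k) * (exp (\<i> * z * t) * of_real (exp (- pi * t\<^sup>2)))) \<in> hermite_closure"
proof (induction k arbitrary: z)
  case 0
  show ?case using exp_gaussian_closure by simp
next
  case (Suc k)
  have "(\<lambda>t. of_real (cos (s * (t - t0)) ^ Suc k) * (exp (\<i> * z * t) * of_real (exp (- pi * t\<^sup>2))))
     = (\<lambda>t. (exp (- (\<i> * s * t0)) / 2) * (of_real (cos (s * (t - t0)) ^ k) * (exp (\<i> * complex_of_real (z + s) * t) * of_real (exp (- pi * t\<^sup>2))))
         + (exp (\<i> * s * t0) / 2) * (of_real (cos (s * (t - t0)) ^ k) * (exp (\<i> * complex_of_real (z - s) * t) * of_real (exp (- pi * t\<^sup>2)))))"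
  proof
    fix t
    have c: "complex_of_real (cos (s * (t - t0))) = (exp (\<i> * (s * (t - t0))) + exp (- (\<i> * (s * (t - t0))))) / 2"
      by (simp add: cos_exp_eq flip: cos_of_real)
    have "exp (\<i> * z * t) * complex_of_real (cos (s * (t - t0)))
       = (exp (- (\<i> * s * t0)) / 2) * exp (\<i> * complex_of_real (z + s) * t) + (exp (\<i> * s * t0) / 2) * exp (\<i> * complex_of_real (z - s) * t)"
      unfolding c by (simp add: algebra_simps add_divide_distrib flip: exp_add)
    then show "of_real (cos (s * (t - t0)) ^ Suc k) * (exp (\<i> * z * t) * of_real (exp (- pi * t\<^sup>2)))
     = (exp (- (\<i> * s * t0)) / 2) * (of_real (cos (s * (t - t0)) ^ k) * (exp (\<i> * complex_of_real (z + s) * t) * of_real (exp (- pi * t\<^sup>2))))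
         + (exp (\<i> * s * t0) / 2) * (of_real (cos (s * (t - t0)) ^ k) * (exp (\<i> * complex_of_real (z - s) * t) * of_real (exp (- pi * t\<^sup>2))))"
      unfolding power_Suc of_real_mult by algebra
  qed
  then show ?case by (simp only:) (intro hermite_closure.add hermite_closure.scale Suc)
qed

text \<open>
  Weierstrass approximation on \<open>[-1, 1]\<close>, the range of the cosine.  Passing through a bounded function
  of \<open>t\<close> keeps the approximants uniformly bounded, as domination requires.
\<close>

lemma continuous_cos_gaussian_closure:
  fixes s t0 :: real
  assumes \<psi>: "continuous_on {-1..1} \<psi>"
  shows "(\<lambda>t. complex_of_real (\<psi> (cos (s * (t - t0))) * exp (- pi * t\<^sup>2))) \<in> hermite_closure"
proof -
  have "\<forall>k. \<exists>p. real_polynomial_function p \<and> (\<forall>x\<in>{-1..1}. \<bar>\<psi> x - p x\<bar> < 1 / real (Suc k))"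
  proof
    fix k
    have "0 < 1 / real (Suc k)" by simp
    then obtain p where "real_polynomial_function p" "\<And>x. x \<in> {-1..1} \<Longrightarrow> \<bar>\<psi> x - p x\<bar> < 1 / real (Suc k)"
      by (rule Stone_Weierstrass_real_polynomial_function[OF compact_Icc \<psi>]) (rule that)
    then show "\<exists>p. real_polynomial_function p \<and> (\<forall>x\<in>{-1..1}. \<bar>\<psi> x - p x\<bar> < 1 / real (Suc k))" by blast
  qed
  from choice[OF this] obtain p where p: "\<And>k. real_polynomial_function (p k)"
    and p_close: "\<And>k x. x \<in> {-1..1} \<Longrightarrow> \<bar>\<psi> x - p k x\<bar> < 1 / real (Suc k)"
    by blast
  have "compact (\<psi> ` {-1..1})" using \<psi> by (rule compact_continuous_image) simp
  then have "bounded (\<psi> ` {-1..1})" by (rule compact_imp_bounded)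
  then obtain B where "\<forall>y\<in>\<psi> ` {-1..1}. norm y \<le> B" unfolding bounded_iff by blast
  then have B: "\<bar>\<psi> x\<bar> \<le> B" if "x \<in> {-1..1}" for x using that by simp
  let ?F = "\<lambda>k t. complex_of_real (p k (cos (s * (t - t0))) * exp (- pi * t\<^sup>2))"
  show ?thesis
  proof (rule hermite_closure.limit)
    show "?F k \<in> hermite_closure" for k
    proof -
      obtain a n where "p k = (\<lambda>x. \<Sum>i\<le>n. a i * x ^ i)"
        using p[of k] unfolding real_polynomial_function_iff_sum by blast
      then have "?F k = (\<lambda>t. \<Sum>i\<le>n. of_real (a i) * (of_real (cos (s * (t - t0)) ^ i) * (exp (\<i> * (0::real) * t) * of_real (exp (- pi * t\<^sup>2)))))"
        by (simp add: sum_distrib_right mult.assoc)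
      then show ?thesis
        using hermite_closure_sum[of "{..n}", OF finite_atMost hermite_closure.scale[OF cos_power_gaussian_closure]]
        by (simp only:)
    qed
    show "(\<lambda>k. ?F k t) \<longlonglongrightarrow> complex_of_real (\<psi> (cos (s * (t - t0))) * exp (- pi * t\<^sup>2))" for t
    proof -
      have "(\<lambda>k. p k (cos (s * (t - t0)))) \<longlonglongrightarrow> \<psi> (cos (s * (t - t0)))"
      proof (rule Lim_transform2)
        show "(\<lambda>k. \<psi> (cos (s * (t - t0)))) \<longlonglongrightarrow> \<psi> (cos (s * (t - t0)))" by simp
        show "(\<lambda>k. \<psi> (cos (s * (t - t0))) - p k (cos (s * (t - t0)))) \<longlonglongrightarrow> 0"
          by (rule LIMSEQ_norm_0) (use p_close in \<open>simp add: real_norm_def\<close>)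
      qed
      then show ?thesis by (intro tendsto_intros)
    qed
    show "cmod (?F k t) \<le> (B + 1) * exp (- pi * t\<^sup>2)" for k t
    proof -
      have c: "cos (s * (t - t0)) \<in> {-1..1}" by simp
      have "1 / real (Suc k) \<le> 1" by simp
      then have "\<bar>p k (cos (s * (t - t0)))\<bar> \<le> B + 1"
        using p_close[OF c, of k] B[OF c] by linarith
      then show ?thesis by (simp add: norm_mult mult_right_mono)
    qed
    show "integrable lborel (\<lambda>t. ((B + 1) * exp (- pi * t\<^sup>2))\<^sup>2)" by (rule integrable_gaussian_square)
  qed measurable
qed

text \<open>
  The indicator of \<open>(c\<^sub>0, \<infinity>)\<close> is the pointwise limit of continuous ramps of slope \<open>k\<close> starting at \<open>c\<^sub>0\<close>.
\<close>

lemma indicator_cos_gaussian_closure: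
  fixes s t0 c0 :: real
  shows "(\<lambda>t. complex_of_real (indicator {c0<..} (cos (s * (t - t0))) * exp (- pi * t\<^sup>2))) \<in> hermite_closure"
proof (rule hermite_closure.limit)
  let ?\<psi> = "\<lambda>k x. min 1 (real k * max 0 (x - c0))"
  let ?F = "\<lambda>k t. complex_of_real (?\<psi> k (cos (s * (t - t0))) * exp (- pi * t\<^sup>2))"
  show "?F k \<in> hermite_closure" for k
    by (rule continuous_cos_gaussian_closure) (intro continuous_intros)
  have "(\<lambda>k. ?\<psi> k x) \<longlonglongrightarrow> indicator {c0<..} x" for x
  proof (cases "x > c0")
    case True
    obtain K :: nat where K: "1 / (x - c0) < real K" using reals_Archimedean2 by blast
    have "?\<psi> k x = 1" if "K \<le> k" for k
    proof -
      have "1 / (x - c0) \<le> real k" using K that by linarith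
      then show ?thesis using True by (simp add: field_simps)
    qed
    then have "\<forall>\<^sub>F k in sequentially. ?\<psi> k x = indicator {c0<..} x"
      using True by (auto simp: eventually_sequentially)
    then show ?thesis by (rule tendsto_eventually)
  qed (simp add: max_def)
  then show "(\<lambda>k. ?F k t) \<longlonglongrightarrow> complex_of_real (indicator {c0<..} (cos (s * (t - t0))) * exp (- pi * t\<^sup>2))" for t
    by (intro tendsto_intros)
  show "cmod (?F k t) \<le> 1 * exp (- pi * t\<^sup>2)" for k t
    by (simp add: norm_mult mult_left_le_one_le)
  show "integrable lborel (\<lambda>t::real. (1 * exp (- pi * t\<^sup>2))\<^sup>2)" by (rule integrable_gaussian_square)
qed measurable

text \<open>
  With \<open>t\<^sub>0\<close> and \<open>r\<close> the centre and half-length of the interval, \<open>{t. cos (s (t - t\<^sub>0)) > cos (s r)}\<close> is the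
  union of the translates of the interval by multiples of \<open>2 \<pi> / s\<close>, once \<open>s r < \<pi>\<close>.  As \<open>s\<close> tends to \<open>0\<close>
  all translates but one move off to infinity.
\<close>

lemma indicator_interval_gaussian_closure:
  fixes a b :: real
  assumes "a < b"
  shows "(\<lambda>t. complex_of_real (indicator {a<..<b} t * exp (- pi * t\<^sup>2))) \<in> hermite_closure"
proof (rule hermite_closure.limit)
  define t0 r where "t0 = (a + b) / 2" and "r = (b - a) / 2"
  have r: "0 < r" using assms by (simp add: r_def)
  define s where "s k = 1 / real (Suc k)" for k
  let ?F = "\<lambda>k t. complex_of_real (indicator {cos (s k * r)<..} (cos (s k * (t - t0))) * exp (- pi * t\<^sup>2))"
  show "?F k \<in> hermite_closure" for k by (rule indicator_cos_gaussian_closure)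
  have "(\<lambda>k. indicator {cos (s k * r)<..} (cos (s k * (t - t0))) :: real) \<longlonglongrightarrow> indicator {a<..<b} t" for t
  proof -
    obtain K :: nat where K: "max r \<bar>t - t0\<bar> / pi < real K" using reals_Archimedean2 by blast
    have "(indicator {cos (s k * r)<..} (cos (s k * (t - t0))) :: real) = indicator {a<..<b} t" if "K \<le> k" for k
    proof -
      have "max r \<bar>t - t0\<bar> / pi \<le> real (Suc k)" using K that by linarith
      then have "max r \<bar>t - t0\<bar> \<le> pi * real (Suc k)" by (simp add: pos_divide_le_eq mult.commute)
      then have *: "s k * r \<le> pi" "s k * \<bar>t - t0\<bar> \<le> pi"
        by (simp_all add: s_def divide_le_eq)
      have s: "s k > 0" by (simp add: s_def)
      have "cos (s k * (t - t0)) = cos (s k * \<bar>t - t0\<bar>)" 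
        using cos_abs_real[of "s k * (t - t0)"] s by (simp add: abs_mult)
      then have "cos (s k * r) < cos (s k * (t - t0)) \<longleftrightarrow> s k * \<bar>t - t0\<bar> < s k * r"
        using * s r by (simp add: cos_mono_less_eq)
      also have "\<dots> \<longleftrightarrow> \<bar>t - t0\<bar> < r" using s by simp
      also have "\<dots> \<longleftrightarrow> t \<in> {a<..<b}" by (auto simp: t0_def r_def abs_less_iff field_simps)
      finally show ?thesis by (simp add: indicator_def)
    qed
    then have "\<forall>\<^sub>F k in sequentially. indicator {cos (s k * r)<..} (cos (s k * (t - t0))) = (indicator {a<..<b} t :: real)"
      by (auto simp: eventually_sequentially)
    then show ?thesis by (rule tendsto_eventually)
  qed
  then show "(\<lambda>k. ?F k t) \<longlonglongrightarrow> complex_of_real (indicator {a<..<b} t * exp (- pi * t\<^sup>2))" for t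
    by (intro tendsto_intros)
  show "cmod (?F k t) \<le> 1 * exp (- pi * t\<^sup>2)" for k t
    by (simp add: norm_mult mult_left_le_one_le)
  show "integrable lborel (\<lambda>t::real. (1 * exp (- pi * t\<^sup>2))\<^sup>2)" by (rule integrable_gaussian_square)
qed measurable

text \<open>
  The sets over which \<open>h\<close> integrates to zero form a Dynkin system, closed under complements because the
  total integral vanishes, and the boxes are a generator stable under intersection.
\<close>

lemma AE_zero_if_integral_box_zero:
  fixes h :: "'a::euclidean_space \<Rightarrow> complex"
  assumes h: "integrable lborel h" and total: "(\<integral>x. h x \<partial>lborel) = 0"
    and box: "\<And>a b. (\<integral>x. indicator (box a b) x *\<^sub>R h x \<partial>lborel) = 0"
  shows "AE x in lborel. h x = 0"
proof -
  have [measurable]: "h \<in> borel_measurable borel" using borel_measurable_integrable[OF h] by simp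
  have si: "integrable lborel (\<lambda>x. indicator A x *\<^sub>R h x)" if "A \<in> sets borel" for A
    using that by (intro integrable_mult_indicator h) simp
  have *: "(\<integral>x. indicator A x *\<^sub>R h x \<partial>lborel) = 0" if "A \<in> sets borel" for A
  proof -
    have "Int_stable (range (\<lambda>(a, b). box a b :: 'a set))"
      by (auto simp: Int_stable_def box_Int_box)
    moreover have "range (\<lambda>(a, b). box a b :: 'a set) \<subseteq> Pow UNIV" by auto
    moreover have "A \<in> sigma_sets UNIV (range (\<lambda>(a, b). box a b))"
      using that unfolding borel_eq_box by simp
    ultimately show ?thesis
    proof (induction rule: sigma_sets_induct_disjoint)
      case (basic A) then show ?case using box by auto
    next
      case empty then show ?case by simp
    next
      case (compl A)
      then have A: "A \<in> sets borel" unfolding borel_eq_box by simp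
      have "(\<lambda>x. indicator (UNIV - A) x *\<^sub>R h x) = (\<lambda>x. h x - indicator A x *\<^sub>R h x)"
        by (auto simp: indicator_def)
      then show ?case using compl total h si[OF A] by simp
    next
      case (union A)
      then have A [measurable]: "A i \<in> sets borel" for i unfolding borel_eq_box by auto
      have "(LINT x:(\<Union>i. A i)|lborel. h x) = (\<Sum>i. LINT x:A i|lborel. h x)"
        using union(1) si[of "\<Union>i. A i"]
        by (intro lebesgue_integral_countable_add) (auto simp: disjoint_family_on_def set_integrable_def)
      then show ?case using union by (simp add: set_lebesgue_integral_def)
    qed
  qed
  have "AE x in lborel. Re (h x) = 0"
  proof (rule density_unique_real)
    fix A :: "'a set" assume "A \<in> sets lborel"
    then have A: "A \<in> sets borel" by simp
    have "(LINT x:A|lborel. Re (h x)) = Re (\<integral>x. indicator A x *\<^sub>R h x \<partial>lborel)"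
      unfolding set_lebesgue_integral_def by (subst integral_Re[symmetric]) (use si[OF A] in auto)
    then show "(LINT x:A|lborel. Re (h x)) = (LINT x:A|lborel. 0)" using *[OF A] by simp
  qed (use h in auto)
  moreover have "AE x in lborel. Im (h x) = 0"
  proof (rule density_unique_real)
    fix A :: "'a set" assume "A \<in> sets lborel"
    then have A: "A \<in> sets borel" by simp
    have "(LINT x:A|lborel. Im (h x)) = Im (\<integral>x. indicator A x *\<^sub>R h x \<partial>lborel)"
      unfolding set_lebesgue_integral_def by (subst integral_Im[symmetric]) (use si[OF A] in auto)
    then show "(LINT x:A|lborel. Im (h x)) = (LINT x:A|lborel. 0)" using *[OF A] by simp
  qed (use h in auto)
  ultimately show ?thesis by eventually_elim (simp add: complex_eq_iff)
qed

lemma hermite_fun_complete: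
  fixes f :: "real^'d::finite \<Rightarrow> complex"
  assumes f: "f \<in> L2" and orth: "\<And>n. L2_inner f (hermite_fun n) = 0"
  shows "AE t in lborel. f t = 0"
proof -
  define e where "e t = (\<Prod>j\<in>UNIV. complex_of_real (exp (- pi * (t $ j)\<^sup>2)))" for t :: "real^'d"
  have e1: "(\<lambda>t::real. complex_of_real (exp (- pi * t\<^sup>2))) \<in> hermite_closure"
    using monomial_gaussian_closure[of 0] by simp
  have eL2: "e \<in> L2"
    unfolding e_def using L2_prod_cart[of "\<lambda>j t. complex_of_real (exp (- pi * t\<^sup>2))"] hermite_closure_L2[OF e1] by simp
  have "AE t in lborel. f t * e t = 0"
  proof (rule AE_zero_if_integral_box_zero)
    show "integrable lborel (\<lambda>t. f t * e t)" by (rule L2_mult_integrable[OF f eL2])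
    show "(\<integral>t. f t * e t \<partial>lborel) = 0"
      unfolding e_def by (rule hermite_closure_annihilated[OF f orth]) (rule e1)
    fix a b :: "real^'d"
    show "(\<integral>t. indicator (box a b) t *\<^sub>R (f t * e t) \<partial>lborel) = 0"
    proof (cases "\<forall>j. a $ j < b $ j")
      case True
      have "indicator (box a b) t *\<^sub>R (f t * e t)
          = f t * (\<Prod>j\<in>UNIV. complex_of_real (indicator {a $ j<..<b $ j} (t $ j) * exp (- pi * (t $ j)\<^sup>2)))" for t
      proof -
        have "indicator (box a b) t = (\<Prod>j\<in>UNIV. indicator {a $ j<..<b $ j} (t $ j) :: real)"
          by (auto simp: indicator_def mem_box_cart)
        then show ?thesis by (simp add: e_def prod.distrib scaleR_conv_of_real)
      qed
      then show ?thesis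
        using hermite_closure_annihilated[OF f orth, of "\<lambda>j t. complex_of_real (indicator {a $ j<..<b $ j} t * exp (- pi * t\<^sup>2))"]
          indicator_interval_gaussian_closure True by simp
    next
      case False
      then have "box a b = {}" by (auto simp: set_eq_iff mem_box_cart intro: less_trans)
      then show ?thesis by simp
    qed
  qed
  then show ?thesis by eventually_elim (simp add: e_def)
qed

section \<open>Weyl transforms of indicators\<close>

lemma lborel_affine_integral:
  fixes h :: "'a::euclidean_space \<Rightarrow> 'b::{banach,second_countable_topology}"
  assumes [measurable]: "h \<in> borel_measurable borel" and "c \<noteq> 0"
  shows "(\<integral>t. h t \<partial>lborel) = \<bar>c\<bar> ^ DIM('a) *\<^sub>R (\<integral>u. h (a + c *\<^sub>R u) \<partial>lborel)"
    and "integrable lborel (\<lambda>u. h (a + c *\<^sub>R u)) \<longleftrightarrow> integrable lborel h"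
proof -
  have "(\<integral>t. h t \<partial>lborel) = (\<integral>t. h t \<partial>density (distr lborel borel (\<lambda>u. a + c *\<^sub>R u)) (\<lambda>_. ennreal (\<bar>c\<bar> ^ DIM('a))))"
    using lborel_affine[OF \<open>c \<noteq> 0\<close>, of a] by simp
  also have "\<dots> = (\<integral>t. \<bar>c\<bar> ^ DIM('a) *\<^sub>R h t \<partial>distr lborel borel (\<lambda>u. a + c *\<^sub>R u))"
    by (rule integral_density) auto
  also have "\<dots> = (\<integral>u. \<bar>c\<bar> ^ DIM('a) *\<^sub>R h (a + c *\<^sub>R u) \<partial>lborel)"
    by (rule integral_distr) auto
  finally show "(\<integral>t. h t \<partial>lborel) = \<bar>c\<bar> ^ DIM('a) *\<^sub>R (\<integral>u. h (a + c *\<^sub>R u) \<partial>lborel)" by simp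
  have "integrable lborel h \<longleftrightarrow> integrable (density (distr lborel borel (\<lambda>u. a + c *\<^sub>R u)) (\<lambda>_. ennreal (\<bar>c\<bar> ^ DIM('a)))) h"
    using lborel_affine[OF \<open>c \<noteq> 0\<close>, of a] by simp
  also have "\<dots> \<longleftrightarrow> integrable (distr lborel borel (\<lambda>u. a + c *\<^sub>R u)) (\<lambda>t. \<bar>c\<bar> ^ DIM('a) *\<^sub>R h t)"
    by (rule integrable_density) auto
  also have "\<dots> \<longleftrightarrow> integrable lborel (\<lambda>u. \<bar>c\<bar> ^ DIM('a) *\<^sub>R h (a + c *\<^sub>R u))"
    by (rule integrable_distr_eq) auto
  finally show "integrable lborel (\<lambda>u. h (a + c *\<^sub>R u)) \<longleftrightarrow> integrable lborel h"
    using \<open>c \<noteq> 0\<close> integrable_scaleR_right[of "\<bar>c\<bar> ^ DIM('a)" lborel "\<lambda>u. h (a + c *\<^sub>R u)"]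
      integrable_scaleR_right[of "1 / \<bar>c\<bar> ^ DIM('a)" lborel "\<lambda>u. \<bar>c\<bar> ^ DIM('a) *\<^sub>R h (a + c *\<^sub>R u)"]
    by auto
qed

text \<open>
  The operator \<open>\<pi>(z) 2\<^sup>d P \<pi>(z)\<^sup>*\<close>: up to the factor \<open>2\<^sup>d\<close> and a phase, reflection at the point \<open>fst z\<close>.
\<close>

definition displaced_parity :: "'d::finite phase \<Rightarrow> (real^'d \<Rightarrow> complex) \<Rightarrow> real^'d \<Rightarrow> complex" where
  "displaced_parity z f u = 2 ^ CARD('d) * exp (- 4 * pi * \<i> * of_real (snd z \<bullet> (fst z - u))) * f (2 *\<^sub>R fst z - u)"

lemma tf_shift_parity_tf_shift_adj:
  "tf_shift z (\<lambda>t. 2 ^ CARD('d) * parity (tf_shift_adj z f) t) = displaced_parity z (f :: real^'d::finite \<Rightarrow> complex)"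
proof
  fix u :: "real^'d"
  obtain x w where z: "z = (x, w)" by (cases z)
  have "2 * pi * \<i> * complex_of_real (u \<bullet> w) + - 2 * pi * \<i> * complex_of_real ((x - u + x) \<bullet> w) = - 4 * pi * \<i> * complex_of_real (w \<bullet> (x - u))"
  proof -
    have c: "(x - u + x) \<bullet> w = 2 * (w \<bullet> x) - w \<bullet> u"
      unfolding inner_commute[of _ w] inner_add_right inner_diff_right by simp
    show ?thesis
      unfolding c inner_commute[of u w] inner_diff_right by (simp add: algebra_simps)
  qed
  then have "exp (2 * pi * \<i> * complex_of_real (u \<bullet> w)) * exp (- 2 * pi * \<i> * complex_of_real ((x - u + x) \<bullet> w)) = exp (- 4 * pi * \<i> * complex_of_real (w \<bullet> (x - u)))"
    by (simp flip: exp_add)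
  moreover have "- (u - x) = x - u" "x - u + x = 2 *\<^sub>R x - u" by (simp_all add: scaleR_2)
  ultimately show "tf_shift z (\<lambda>t. 2 ^ CARD('d) * parity (tf_shift_adj z f) t) u = displaced_parity z f u"
    by (simp add: z tf_shift_def tf_shift_adj_def parity_def displaced_parity_def mult_ac)
qed

text \<open>
  The substitution \<open>t = 2 (x - u)\<close>, which produces the factor \<open>2\<^sup>d\<close>.
\<close>

lemma wigner_eq_displaced_parity:
  fixes f g :: "real^'d::finite \<Rightarrow> complex"
  assumes f: "f \<in> L2" and g: "g \<in> L2"
  shows "wigner f g z = L2_inner (displaced_parity z f) g"
proof -
  obtain x w where z: "z = (x, w)" by (cases z)
  have [measurable]: "f \<in> borel_measurable borel" "g \<in> borel_measurable borel" using f g by measurable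
  have [measurable]: "cnj \<in> borel_measurable borel"
    by (intro borel_measurable_continuous_onI continuous_intros)
  have e: "x + (2 *\<^sub>R x + (- 2) *\<^sub>R u) /\<^sub>R 2 = 2 *\<^sub>R x - u" "x - (2 *\<^sub>R x + (- 2) *\<^sub>R u) /\<^sub>R 2 = u" for u
  proof -
    have "(2 *\<^sub>R x + (- 2) *\<^sub>R u) /\<^sub>R 2 = x - u"
      unfolding scaleR_add_right scaleR_scaleR by simp
    then show "x + (2 *\<^sub>R x + (- 2) *\<^sub>R u) /\<^sub>R 2 = 2 *\<^sub>R x - u" "x - (2 *\<^sub>R x + (- 2) *\<^sub>R u) /\<^sub>R 2 = u"
      by (simp_all add: scaleR_2)
  qed
  have e2: "- 2 * pi * \<i> * complex_of_real (w \<bullet> (2 *\<^sub>R x + (- 2) *\<^sub>R u)) = - 4 * pi * \<i> * complex_of_real (w \<bullet> (x - u))" for u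
    unfolding inner_add_right inner_scaleR_right inner_diff_right by (simp add: algebra_simps)
  have "wigner f g z = \<bar>-2\<bar> ^ DIM(real^'d) *\<^sub>R (\<integral>u. f (x + (2 *\<^sub>R x + (- 2) *\<^sub>R u) /\<^sub>R 2) * cnj (g (x - (2 *\<^sub>R x + (- 2) *\<^sub>R u) /\<^sub>R 2))
                              * exp (- 2 * pi * \<i> * of_real (w \<bullet> (2 *\<^sub>R x + (- 2) *\<^sub>R u))) \<partial>lborel)"
    unfolding z wigner_def prod.case by (rule lborel_affine_integral) auto
  also have "\<dots> = (\<integral>u. 2 ^ CARD('d) * (f (2 *\<^sub>R x - u) * cnj (g u) * exp (- 4 * pi * \<i> * complex_of_real (w \<bullet> (x - u)))) \<partial>lborel)"
    unfolding e e2 by (simp add: scaleR_conv_of_real)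
  also have "\<dots> = L2_inner (displaced_parity z f) g"
    unfolding L2_inner_def displaced_parity_def z by (simp add: mult_ac)
  finally show ?thesis .
qed

lemma cnj_wigner:
  fixes f g :: "real^'d::finite \<Rightarrow> complex"
  assumes f: "f \<in> L2" and g: "g \<in> L2"
  shows "cnj (wigner g f z) = wigner f g z"
proof -
  obtain x w where z: "z = (x, w)" by (cases z)
  have [measurable]: "f \<in> borel_measurable borel" "g \<in> borel_measurable borel" using f g by measurable
  have [measurable]: "cnj \<in> borel_measurable borel"
    by (intro borel_measurable_continuous_onI continuous_intros)
  have "wigner f g z = \<bar>-1\<bar> ^ DIM(real^'d) *\<^sub>R (\<integral>u. f (x + (0 + (- 1) *\<^sub>R u) /\<^sub>R 2) * cnj (g (x - (0 + (- 1) *\<^sub>R u) /\<^sub>R 2))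
                              * exp (- 2 * pi * \<i> * of_real (w \<bullet> (0 + (- 1) *\<^sub>R u))) \<partial>lborel)"
    unfolding z wigner_def prod.case by (rule lborel_affine_integral) auto
  also have "\<dots> = (\<integral>u. cnj (g (x + u /\<^sub>R 2) * cnj (f (x - u /\<^sub>R 2)) * exp (- 2 * pi * \<i> * of_real (w \<bullet> u))) \<partial>lborel)"
    by (simp add: mult_ac exp_cnj)
  also have "\<dots> = cnj (wigner g f z)"
    unfolding z wigner_def prod.case by (rule Bochner_Integration.integral_cnj)
  finally show ?thesis ..
qed

text \<open>
  The integrands of the two weak definitions coincide pointwise, so the two predicates are equal, and with
  them the operators that they select.
\<close>

lemma is_op_convolution_iff_is_weyl_transform:
  "is_op_convolution F (\<lambda>f t. 2 ^ CARD('d) * parity f t) = is_weyl_transform (F :: 'd::finite phase \<Rightarrow> complex)"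
proof
  fix L
  have "L2_inner (displaced_parity z f) g = cnj (wigner g f z)" if "f \<in> L2" "g \<in> L2" for z and f g :: "real^'d \<Rightarrow> complex"
    unfolding cnj_wigner[OF that] wigner_eq_displaced_parity[OF that] by (rule refl)
  then show "is_op_convolution F (\<lambda>f t. 2 ^ CARD('d) * parity f t) L = is_weyl_transform F L"
    unfolding is_op_convolution_def is_weyl_transform_def tf_shift_parity_tf_shift_adj
    by (simp add: L2_inner_def[of F] cong: ball_cong)
qed

lemma cmod_displaced_parity: "(cmod (displaced_parity z f u))\<^sup>2 = 4 ^ CARD('d) * (cmod (f (2 *\<^sub>R fst z - u)))\<^sup>2"
  for f :: "real^'d::finite \<Rightarrow> complex"
proof -
  have "((2::real) ^ CARD('d))\<^sup>2 = 4 ^ CARD('d)" by (simp flip: power_mult power_mult_distrib add: mult.commute[of _ 2] power_mult)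
  then show ?thesis by (simp add: displaced_parity_def norm_mult norm_power power_mult_distrib)
qed

lemma measurable_displaced_parity [measurable]:
  fixes f :: "real^'d::finite \<Rightarrow> complex"
  assumes [measurable]: "f \<in> borel_measurable borel" "a \<in> borel_measurable M" "b \<in> borel_measurable M"
  shows "(\<lambda>y. displaced_parity (a y) f (b y)) \<in> borel_measurable M"
proof -
  have [measurable]: "fst \<in> borel_measurable (borel :: 'd phase measure)" "snd \<in> borel_measurable (borel :: 'd phase measure)"
    by (intro borel_measurable_continuous_onI continuous_intros)+
  show ?thesis unfolding displaced_parity_def by measurable
qed

lemma displaced_parity_L2:
  fixes f :: "real^'d::finite \<Rightarrow> complex"
  assumes f: "f \<in> L2"
  shows "displaced_parity z f \<in> L2"
    and "(\<integral>u. (cmod (displaced_parity z f u))\<^sup>2 \<partial>lborel) = 4 ^ CARD('d) * (\<integral>u. (cmod (f u))\<^sup>2 \<partial>lborel)"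
proof -
  have [measurable]: "f \<in> borel_measurable borel" using f by measurable
  have i: "integrable lborel (\<lambda>u. (cmod (f u))\<^sup>2)" using f by (simp add: L2_def)
  have "integrable lborel (\<lambda>u. (cmod (f (2 *\<^sub>R fst z + (- 1) *\<^sub>R u)))\<^sup>2)"
    by (subst lborel_affine_integral(2)) (use i in auto)
  then show "displaced_parity z f \<in> L2"
    by (simp add: L2_def cmod_displaced_parity)
  have "(\<integral>u. (cmod (f u))\<^sup>2 \<partial>lborel) = \<bar>-1\<bar> ^ DIM(real^'d) *\<^sub>R (\<integral>u. (cmod (f (2 *\<^sub>R fst z + (- 1) *\<^sub>R u)))\<^sup>2 \<partial>lborel)"
    by (rule lborel_affine_integral) auto
  then show "(\<integral>u. (cmod (displaced_parity z f u))\<^sup>2 \<partial>lborel) = 4 ^ CARD('d) * (\<integral>u. (cmod (f u))\<^sup>2 \<partial>lborel)"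
    by (simp add: cmod_displaced_parity)
qed

lemma L2_cnj: "g \<in> L2 \<Longrightarrow> (\<lambda>x. cnj (g x)) \<in> L2"
proof -
  have [measurable]: "cnj \<in> borel_measurable borel"
    by (intro borel_measurable_continuous_onI continuous_intros)
  assume g: "g \<in> L2"
  then have [measurable]: "g \<in> borel_measurable borel" by measurable
  show "(\<lambda>x. cnj (g x)) \<in> L2" using g by (simp add: L2_def)
qed

text \<open>
  Fubini on the product of a set of finite measure with the whole space, for integrands whose slices
  have uniformly bounded \<open>L\<^sup>1\<close> norm.  It is applied to the square of a displaced parity and to its
  product with a second function.
\<close>

lemma integrable_pair_bounded_slices:
  fixes f :: "real^'d::finite \<Rightarrow> complex" and H :: "'d phase \<Rightarrow> real^'d \<Rightarrow> 'b::{banach,second_countable_topology}"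
  assumes [measurable]: "\<Omega> \<in> sets borel" and fin: "emeasure lborel \<Omega> < \<infinity>"
    and meas: "(\<lambda>(z, u). H z u) \<in> borel_measurable (lborel \<Otimes>\<^sub>M lborel)"
    and int: "\<And>z. integrable lborel (H z)"
    and bound: "\<And>z. (\<integral>u. norm (H z u) \<partial>lborel) \<le> B"
  shows "integrable (lborel \<Otimes>\<^sub>M lborel) (\<lambda>(z, u). indicator \<Omega> z *\<^sub>R H z u)"
proof (rule lborel_pair.Fubini_integrable)
  note [measurable] = meas
  show "(\<lambda>(z, u). indicator \<Omega> z *\<^sub>R H z u) \<in> borel_measurable (lborel \<Otimes>\<^sub>M lborel)" by measurable
  have [measurable]: "(\<lambda>z. \<integral>u. norm (H z u) \<partial>lborel) \<in> borel_measurable lborel" by measurable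
  have "integrable lborel (\<lambda>z. indicator \<Omega> z * (\<integral>u. norm (H z u) \<partial>lborel))"
  proof (rule Bochner_Integration.integrable_bound)
    show "integrable lborel (\<lambda>z. indicator \<Omega> z * B)"
      using fin by (intro integrable_mult_left integrable_real_indicator) auto
    show "AE z in lborel. norm (indicator \<Omega> z * (\<integral>u. norm (H z u) \<partial>lborel)) \<le> norm (indicator \<Omega> z * B)"
      using bound by (intro AE_I2) (auto simp: indicator_def intro: order_trans[OF _ abs_ge_self])
  qed measurable
  then show "integrable lborel (\<lambda>z. \<integral>u. norm (case (z, u) of (z, u) \<Rightarrow> indicator \<Omega> z *\<^sub>R H z u) \<partial>lborel)"
    by simp
  show "AE z in lborel. integrable lborel (\<lambda>u. case (z, u) of (z, u) \<Rightarrow> indicator \<Omega> z *\<^sub>R H z u)"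
    using int by simp
qed

text \<open>
  The integral of \<open>(|h| - s)\<^sup>2\<close> over \<open>A\<close> is a nonnegative quadratic polynomial in \<open>s\<close>.
\<close>

lemma indicator_integral_Cauchy_Schwarz:
  fixes h :: "'a \<Rightarrow> complex"
  assumes [measurable]: "A \<in> sets M" "h \<in> borel_measurable M" and fin: "emeasure M A < \<infinity>"
    and sq: "integrable M (\<lambda>x. indicator A x * (cmod (h x))\<^sup>2)"
  shows "(cmod (\<integral>x. indicator A x * h x \<partial>M))\<^sup>2 \<le> measure M A * (\<integral>x. indicator A x * (cmod (h x))\<^sup>2 \<partial>M)"
proof -
  define m a V where "m = measure M A" and "a = (\<integral>x. indicator A x * cmod (h x) \<partial>M)"
    and "V = (\<integral>x. indicator A x * (cmod (h x))\<^sup>2 \<partial>M)"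
  have i0: "integrable M (indicator A :: 'a \<Rightarrow> real)" using fin by (intro integrable_real_indicator) auto
  have i1: "integrable M (\<lambda>x. indicator A x * cmod (h x))"
  proof (rule Bochner_Integration.integrable_bound)
    show "integrable M (\<lambda>x. indicator A x + indicator A x * (cmod (h x))\<^sup>2)"
      using i0 sq by simp
    have "y \<le> 1 + y\<^sup>2" for y :: real
    proof -
      have "0 \<le> (y - 1 / 2) * (y - 1 / 2)" by simp
      then show ?thesis by (simp add: algebra_simps power2_eq_square)
    qed
    then show "AE x in M. norm (indicator A x * cmod (h x)) \<le> norm (indicator A x + indicator A x * (cmod (h x))\<^sup>2 :: real)"
      by (intro AE_I2) (auto simp: indicator_def)
  qed measurable
  have q: "0 \<le> V - 2 * s * a + s\<^sup>2 * m" for s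
  proof -
    have "0 \<le> (\<integral>x. indicator A x * (cmod (h x) - s)\<^sup>2 \<partial>M)" by (intro Bochner_Integration.integral_nonneg) auto
    also have "\<dots> = (\<integral>x. indicator A x * (cmod (h x))\<^sup>2 - 2 * s * (indicator A x * cmod (h x)) + s\<^sup>2 * indicator A x \<partial>M)"
      by (simp add: power2_diff algebra_simps)
    also have "\<dots> = V - 2 * s * a + s\<^sup>2 * m"
      using i0 i1 sq by (simp add: V_def a_def m_def)
    finally show ?thesis .
  qed
  have "a\<^sup>2 \<le> m * V"
  proof (cases "m = 0")
    case True
    have "a = 0"
    proof (rule ccontr)
      assume "a \<noteq> 0"
      then show False using q[of "(V + 1) / (2 * a)"] True by simp
    qed
    then show ?thesis using True by simp
  next
    case False
    then have "0 < m" by (simp add: m_def less_le)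
    then show ?thesis using q[of "a / m"] by (simp add: power2_eq_square field_simps)
  qed
  moreover have "cmod (\<integral>x. indicator A x * h x \<partial>M) \<le> a"
  proof -
    have "cmod (indicator A x * h x) = indicator A x * cmod (h x)" for x by (simp add: indicator_def)
    then show ?thesis
      unfolding a_def using integral_norm_bound[of M "\<lambda>x. indicator A x * h x"] by simp
  qed
  ultimately show ?thesis
    unfolding V_def m_def using power_mono[OF _ norm_ge_zero, of "\<integral>x. indicator A x * h x \<partial>M" a 2] by linarith
qed

definition indicator_weyl_operator :: "'d phase set \<Rightarrow> 'd::finite operator" where
  "indicator_weyl_operator \<Omega> f u = (\<integral>z. indicator \<Omega> z * displaced_parity z f u \<partial>lborel)"

text \<open>
  For fixed \<open>u\<close>, Cauchy-Schwarz over \<open>\<Omega>\<close> bounds the square of the value at \<open>u\<close> by the measure of \<open>\<Omega>\<close> times an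
  integral over \<open>\<Omega>\<close>; integrating in \<open>u\<close> first shows that the latter is integrable, because each
  displaced parity multiplies the \<open>L\<^sup>2\<close> norm by \<open>2\<^sup>d\<close>.  The weak identity is Fubini.
\<close>

lemma indicator_weyl_operator_is_weyl_transform:
  fixes \<Omega> :: "'d::finite phase set"
  assumes [measurable]: "\<Omega> \<in> sets borel" and fin: "emeasure lborel \<Omega> < \<infinity>"
  shows "is_weyl_transform (indicator \<Omega>) (indicator_weyl_operator \<Omega>)"
  unfolding is_weyl_transform_def
proof (intro ballI conjI)
  fix f :: "real^'d \<Rightarrow> complex" assume f: "f \<in> L2"
  have [measurable]: "f \<in> borel_measurable borel" using f by measurable
  let ?Q = "\<lambda>z u. displaced_parity z f u"
  have Tm [measurable]: "indicator_weyl_operator \<Omega> f \<in> borel_measurable borel"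
    unfolding indicator_weyl_operator_def[abs_def] by measurable
  show "indicator_weyl_operator \<Omega> f \<in> L2"
  proof -
    have J: "integrable (lborel \<Otimes>\<^sub>M lborel) (\<lambda>(z, u). indicator \<Omega> z *\<^sub>R (cmod (?Q z u))\<^sup>2)"
      by (rule integrable_pair_bounded_slices[OF _ fin, where B="4 ^ CARD('d) * (\<integral>u. (cmod (f u))\<^sup>2 \<partial>lborel)"])
         (use displaced_parity_L2[OF f] in \<open>simp_all add: L2_def\<close>)
    have "integrable lborel (\<lambda>u. \<integral>z. indicator \<Omega> z *\<^sub>R (cmod (?Q z u))\<^sup>2 \<partial>lborel)"
      using lborel_pair.integrable_snd[OF J] by simp
    then have I: "integrable lborel (\<lambda>u. measure lborel \<Omega> * (\<integral>z. indicator \<Omega> z * (cmod (?Q z u))\<^sup>2 \<partial>lborel))"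
      by (intro integrable_mult_right) simp
    \<comment> \<open>Fubini provides a finite integral only for almost every point, which suffices for the bound.\<close>
    have "AE u in lborel. integrable lborel (\<lambda>z. indicator \<Omega> z *\<^sub>R (cmod (?Q z u))\<^sup>2)"
      using lborel_pair.AE_integrable_snd[OF J] by simp
    then have "AE u in lborel. norm ((cmod (indicator_weyl_operator \<Omega> f u))\<^sup>2)
        \<le> norm (measure lborel \<Omega> * (\<integral>z. indicator \<Omega> z * (cmod (?Q z u))\<^sup>2 \<partial>lborel))"
    proof eventually_elim
      case (elim u)
      have "(cmod (indicator_weyl_operator \<Omega> f u))\<^sup>2
          \<le> measure lborel \<Omega> * (\<integral>z. indicator \<Omega> z * (cmod (?Q z u))\<^sup>2 \<partial>lborel)"
        unfolding indicator_weyl_operator_def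
        by (rule indicator_integral_Cauchy_Schwarz) (use fin elim in auto)
      then show ?case by (simp add: order_trans[OF _ abs_ge_self])
    qed
    then have "integrable lborel (\<lambda>u. (cmod (indicator_weyl_operator \<Omega> f u))\<^sup>2)"
      by (intro Bochner_Integration.integrable_bound[OF I]) auto
    then show ?thesis by (simp add: L2_def)
  qed
  fix g :: "real^'d \<Rightarrow> complex" assume g: "g \<in> L2"
  have [measurable]: "g \<in> borel_measurable borel" using g by measurable
  have [measurable]: "cnj \<in> borel_measurable borel"
    by (intro borel_measurable_continuous_onI continuous_intros)
  have Qi: "integrable lborel (\<lambda>u. ?Q z u * cnj (g u))" for z
    by (intro L2_mult_integrable displaced_parity_L2 f L2_cnj g)
  have J: "integrable (lborel \<Otimes>\<^sub>M lborel) (\<lambda>(z, u). indicator \<Omega> z *\<^sub>R (?Q z u * cnj (g u)))"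
  proof (rule integrable_pair_bounded_slices[OF _ fin])
    fix z
    have "(\<integral>u. norm (?Q z u * cnj (g u)) \<partial>lborel) \<le> (\<integral>u. (cmod (?Q z u))\<^sup>2 + (cmod (g u))\<^sup>2 \<partial>lborel)"
    proof (rule integral_mono)
      show "integrable lborel (\<lambda>u. norm (?Q z u * cnj (g u)))" using Qi by (rule integrable_norm)
      show "integrable lborel (\<lambda>u. (cmod (?Q z u))\<^sup>2 + (cmod (g u))\<^sup>2)"
        using displaced_parity_L2(1)[OF f, of z] g by (simp add: L2_def)
      show "norm (?Q z u * cnj (g u)) \<le> (cmod (?Q z u))\<^sup>2 + (cmod (g u))\<^sup>2" for u
      proof -
        have "2 * (cmod (?Q z u) * cmod (g u)) \<le> (cmod (?Q z u))\<^sup>2 + (cmod (g u))\<^sup>2" "0 \<le> cmod (?Q z u) * cmod (g u)"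
          using sum_squares_bound[of "cmod (?Q z u)" "cmod (g u)"] by (simp_all add: mult.assoc)
        then show ?thesis unfolding norm_mult complex_mod_cnj by linarith
      qed
    qed
    also have "\<dots> = 4 ^ CARD('d) * (\<integral>u. (cmod (f u))\<^sup>2 \<partial>lborel) + (\<integral>u. (cmod (g u))\<^sup>2 \<partial>lborel)"
      using displaced_parity_L2[OF f, of z] g by (subst Bochner_Integration.integral_add) (simp_all add: L2_def)
    finally show "(\<integral>u. norm (?Q z u * cnj (g u)) \<partial>lborel) \<le> \<dots>" .
  qed (use Qi in auto)
  have W: "(\<integral>u. indicator \<Omega> z *\<^sub>R (?Q z u * cnj (g u)) \<partial>lborel) = indicator \<Omega> z * cnj (wigner g f z)" for z
    by (simp add: cnj_wigner[OF f g] wigner_eq_displaced_parity[OF f g] L2_inner_def scaleR_conv_of_real of_real_indicator)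
  show "integrable lborel (\<lambda>z. indicator \<Omega> z * cnj (wigner g f z))"
    using lborel_pair.integrable_fst[OF J] by (simp only: W prod.case)
  have "L2_inner (indicator_weyl_operator \<Omega> f) g = (\<integral>u. (\<integral>z. indicator \<Omega> z *\<^sub>R (?Q z u * cnj (g u)) \<partial>lborel) \<partial>lborel)"
    unfolding L2_inner_def indicator_weyl_operator_def
    by (simp add: scaleR_conv_of_real of_real_indicator mult.assoc flip: integral_mult_left_zero)
  also have "\<dots> = (\<integral>z. (\<integral>u. indicator \<Omega> z *\<^sub>R (?Q z u * cnj (g u)) \<partial>lborel) \<partial>lborel)"
    using lborel_pair.Fubini_integral[OF J] by simp
  also have "\<dots> = L2_inner (indicator \<Omega>) (wigner g f)"
    unfolding W L2_inner_def by simp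
  finally show "L2_inner (indicator_weyl_operator \<Omega> f) g = L2_inner (indicator \<Omega>) (wigner g f)" .
qed

section \<open>Eigenvalues\<close>

lemma lp_radial_ball_nonneg: "r \<in> lp_radial_ball p R \<Longrightarrow> 0 \<le> r $ i"
  by (simp add: lp_radial_ball_def)

lemma lp_radial_ball_borel: "(lp_radial_ball p R :: (real^'d::finite) set) \<in> sets borel"
proof (cases "p = \<infinity>")
  case True
  then have "lp_radial_ball p R = {r :: real^'d. (\<forall>i. 0 \<le> r $ i) \<and> (\<forall>i. r $ i \<le> R)}"
    by (auto simp: lp_radial_ball_def Max_le_iff)
  moreover have "\<dots> \<in> sets borel"
    by measurable
  ultimately show ?thesis by simp
next
  case False
  then have "lp_radial_ball p R = {r :: real^'d. (\<forall>i. 0 \<le> r $ i) \<and>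
      (\<Sum>i\<in>UNIV. (r $ i) powr real_of_ereal p) \<le> R powr real_of_ereal p}"
    by (auto simp: lp_radial_ball_def)
  moreover have "\<dots> \<in> sets borel"
    by measurable
  ultimately show ?thesis by simp
qed

lemma mem_lp_phase_ball_iff: "z \<in> lp_phase_ball p R \<longleftrightarrow> radii z \<in> lp_radial_ball p R"
proof -
  have "cmod (Complex a b) = norm (a, b)" for a b by (simp add: cmod_def norm_Pair)
  then show ?thesis
    by (cases z) (simp add: lp_phase_ball_def lp_radial_ball_def radii_def)
qed

lemma lp_radial_ball_bound:
  assumes "0 < p" and "0 < R" and r: "r \<in> lp_radial_ball p R"
  shows "r $ i \<le> R"
proof (cases "p = \<infinity>")
  case True
  then show ?thesis using r by (simp add: lp_radial_ball_def)
next
  case False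
  then have q: "0 < real_of_ereal p" using \<open>0 < p\<close> by (cases p) auto
  have "(r $ i) powr real_of_ereal p \<le> (\<Sum>i\<in>UNIV. (r $ i) powr real_of_ereal p)"
    by (rule member_le_sum) auto
  also have "\<dots> \<le> R powr real_of_ereal p" using r False by (simp add: lp_radial_ball_def)
  finally show ?thesis
    using powr_less_mono2[OF q, of R "r $ i"] \<open>0 < R\<close> by (meson less_imp_le not_le)
qed

lemma emeasure_lp_phase_ball_finite:
  assumes "0 < p" and "0 < R"
  shows "emeasure lborel (lp_phase_ball p R :: 'd::finite phase set) < \<infinity>"
proof (rule emeasure_bounded_finite, rule bounded_subset[OF bounded_cbox])
  show "(lp_phase_ball p R :: 'd phase set) \<subseteq> cbox (\<chi> i. - R, \<chi> i. - R) (\<chi> i. R, \<chi> i. R)"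
  proof
    fix z :: "'d phase" assume "z \<in> lp_phase_ball p R"
    then have "radii z $ i \<le> R" for i
      using lp_radial_ball_bound[OF assms] by (simp add: mem_lp_phase_ball_iff)
    then have "norm (fst z $ i, snd z $ i) \<le> R" for i by (simp add: radii_def)
    then have "\<bar>fst z $ i\<bar> \<le> R" "\<bar>snd z $ i\<bar> \<le> R" for i
      using norm_fst_le[of "fst z $ i" "snd z $ i"] norm_snd_le[of "snd z $ i" "fst z $ i"] order_trans
      unfolding real_norm_def by blast+
    then have "fst z \<in> cbox (\<chi> i. - R) (\<chi> i. R)" "snd z \<in> cbox (\<chi> i. - R) (\<chi> i. R)"
      by (simp_all add: mem_box_cart abs_le_iff minus_le_iff)
    then show "z \<in> cbox (\<chi> i. - R, \<chi> i. - R) (\<chi> i. R, \<chi> i. R)"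
      by (simp add: cbox_Pair_eq mem_Times_iff)
  qed
qed

lemma L2_inner_cnj: "cnj (L2_inner f g) = L2_inner g f"
proof -
  have "cnj (L2_inner f g) = (\<integral>x. cnj (f x * cnj (g x)) \<partial>lborel)"
    unfolding L2_inner_def by (rule Bochner_Integration.integral_cnj[symmetric])
  then show ?thesis by (simp add: L2_inner_def mult.commute)
qed

lemma L2_inner_diff_scale:
  assumes "f \<in> L2" "g \<in> L2" "h \<in> L2"
  shows "L2_inner (\<lambda>x. f x - c * g x) h = L2_inner f h - c * L2_inner g h"
proof -
  have i: "integrable lborel (\<lambda>x. f x * cnj (h x))" "integrable lborel (\<lambda>x. g x * cnj (h x))"
    using assms by (auto intro: L2_mult_integrable L2_cnj)
  have "L2_inner (\<lambda>x. f x - c * g x) h = (\<integral>x. f x * cnj (h x) - c * (g x * cnj (h x)) \<partial>lborel)"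
    unfolding L2_inner_def by (simp add: algebra_simps)
  also have "\<dots> = L2_inner f h - c * L2_inner g h"
    unfolding L2_inner_def using i by simp
  finally show ?thesis .
qed

lemma L2_inner_cong_AE:
  assumes "AE x in lborel. f x = f' x" and "f \<in> L2" "f' \<in> L2" "g \<in> L2"
  shows "L2_inner f g = L2_inner f' g"
  unfolding L2_inner_def
proof (rule integral_cong_AE)
  show "AE x in lborel. f x * cnj (g x) = f' x * cnj (g x)"
    using assms(1) by eventually_elim simp
qed (use assms L2_mult_integrable[OF _ L2_cnj] in \<open>blast intro: borel_measurable_integrable\<close>)+

lemma hermite_fun_basis: "is_orthonormal_basis (hermite_fun :: nat^'d::finite \<Rightarrow> real^'d \<Rightarrow> complex)"
  unfolding is_orthonormal_basis_def
  by (simp add: hermite_fun_in_L2 hermite_fun_orthonormal) (use hermite_fun_complete in blast)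

text \<open>
  Subtracting \<open>\<lambda>\<^sub>n \<phi>\<^sub>n\<close> from \<open>L \<phi>\<^sub>n\<close> leaves a function orthogonal to every Hermite function, since the matrix
  of \<open>L\<close> is diagonal; by completeness it is zero.
\<close>

lemma polyradial_weyl_hermite:
  fixes W :: "(real^'d::finite) set"
  assumes W [measurable]: "W \<in> sets borel" and pos: "\<And>r i. r \<in> W \<Longrightarrow> 0 \<le> r $ i"
    and L: "is_weyl_transform (\<lambda>z. indicator W (radii z)) L"
  defines "lam \<equiv> (\<lambda>n :: nat^'d. (4 * pi) ^ CARD('d) * (- 1) ^ (\<Sum>j\<in>UNIV. n $ j)
                      * (LINT r:W|lborel. (\<Prod>j\<in>UNIV. exp (- 2 * pi * (r $ j)\<^sup>2)
                                         * laguerre (n $ j) (4 * pi * (r $ j)\<^sup>2) * r $ j)))"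
  shows "is_eigenfunction L (of_real (lam n)) (hermite_fun n)"
proof -
  let ?F = "\<lambda>z. indicator W (radii z) :: complex"
  have Lh: "L (hermite_fun n) \<in> L2" using L hermite_fun_in_L2 by (auto simp: is_weyl_transform_def)
  let ?D = "\<lambda>t. L (hermite_fun n) t - of_real (lam n) * hermite_fun n t"
  have D: "?D \<in> L2"
    using L2_add[OF Lh L2_scale[OF hermite_fun_in_L2, of "- of_real (lam n)" n]] by simp
  have "L2_inner ?D (hermite_fun m) = 0" for m
  proof -
    have "L2_inner (L (hermite_fun n)) (hermite_fun m) = L2_inner ?F (wigner (hermite_fun m) (hermite_fun n))"
      using L hermite_fun_in_L2 by (auto simp: is_weyl_transform_def)
    also have "\<dots> = (\<integral>z. ?F z * wigner (hermite_fun n) (hermite_fun m) z \<partial>lborel)"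
      by (simp add: L2_inner_def cnj_wigner hermite_fun_in_L2)
    also have "\<dots> = (if n = m then of_real (lam n) else 0)"
      using integral_wigner_hermite_off_diagonal[OF W, of n m] integral_wigner_hermite_diagonal[OF W pos, of n]
      by (auto simp: lam_def)
    finally show ?thesis
      by (simp add: L2_inner_diff_scale Lh hermite_fun_in_L2 hermite_fun_orthonormal)
  qed
  then have "AE t in lborel. ?D t = 0" by (rule hermite_fun_complete[OF D])
  moreover have "\<not> (AE t in lborel. hermite_fun n t = 0)"
  proof
    assume "AE t in lborel. hermite_fun n t = 0"
    then have "L2_inner (hermite_fun n) (hermite_fun n) = 0"
      unfolding L2_inner_def by (intro integral_eq_zero_AE) (auto elim: eventually_mono)
    then show False by (simp add: hermite_fun_orthonormal)
  qed
  ultimately show ?thesis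
    unfolding is_eigenfunction_def using hermite_fun_in_L2 by (auto elim: eventually_mono)
qed

lemma weyl_transform_real_symmetric:
  assumes L: "is_weyl_transform F L" and real: "\<And>z. cnj (F z) = F z" and f: "f \<in> L2" and g: "g \<in> L2"
  shows "L2_inner (L f) g = L2_inner f (L g)"
proof -
  have "L2_inner f (L g) = cnj (L2_inner F (wigner f g))"
    using L f g by (metis L2_inner_cnj is_weyl_transform_def)
  also have "\<dots> = (\<integral>z. cnj (F z * cnj (wigner f g z)) \<partial>lborel)"
    unfolding L2_inner_def by (rule Bochner_Integration.integral_cnj[symmetric])
  also have "\<dots> = L2_inner F (wigner g f)"
    unfolding L2_inner_def by (simp add: real cnj_wigner[OF f g])
  also have "\<dots> = L2_inner (L f) g"
    using L f g by (simp add: is_weyl_transform_def)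
  finally show ?thesis ..
qed

text \<open>
  Symmetry gives \<open>\<mu> \<langle>f, e\<^sub>n\<rangle> = \<langle>L f, e\<^sub>n\<rangle> = \<lambda>\<^sub>n \<langle>f, e\<^sub>n\<rangle>\<close>, so a nonzero coefficient forces \<open>\<mu> = \<lambda>\<^sub>n\<close>, and an
  eigenfunction has at least one nonzero coefficient.
\<close>

lemma spectrum_from_eigenbasis:
  fixes e :: "'i \<Rightarrow> real^'d::finite \<Rightarrow> complex" and lam :: "'i \<Rightarrow> real"
  assumes basis: "is_orthonormal_basis e"
    and eig: "\<And>n. is_eigenfunction L (of_real (lam n)) (e n)"
    and L: "\<And>f. f \<in> L2 \<Longrightarrow> L f \<in> L2"
    and sym: "\<And>f g. f \<in> L2 \<Longrightarrow> g \<in> L2 \<Longrightarrow> L2_inner (L f) g = L2_inner f (L g)"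
    and f: "is_eigenfunction L \<mu> f"
  shows "\<exists>n. \<mu> = of_real (lam n)" and "of_real (lam n) \<noteq> \<mu> \<Longrightarrow> L2_inner f (e n) = 0"
proof -
  have fL2: "f \<in> L2" and nz: "\<not> (AE t in lborel. f t = 0)" and Lf: "AE t in lborel. L f t = \<mu> * f t"
    using f by (auto simp: is_eigenfunction_def)
  have e: "e n \<in> L2" for n using basis by (simp add: is_orthonormal_basis_def)
  have *: "(\<mu> - of_real (lam n)) * L2_inner f (e n) = 0" for n
  proof -
    have "\<mu> * L2_inner f (e n) = L2_inner (\<lambda>t. \<mu> * f t) (e n)"
      unfolding L2_inner_def by (simp add: mult.assoc)
    also have "\<dots> = L2_inner (L f) (e n)"
      by (rule L2_inner_cong_AE[symmetric]) (use Lf L fL2 e L2_scale in auto)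
    also have "\<dots> = L2_inner f (L (e n))" using sym fL2 e by blast
    also have "\<dots> = cnj (L2_inner (L (e n)) f)" by (simp add: L2_inner_cnj)
    also have "L2_inner (L (e n)) f = L2_inner (\<lambda>t. of_real (lam n) * e n t) f"
      by (rule L2_inner_cong_AE) (use eig L fL2 e L2_scale[OF e] in \<open>auto simp: is_eigenfunction_def\<close>)
    also have "\<dots> = of_real (lam n) * L2_inner (e n) f"
      unfolding L2_inner_def by (simp add: mult.assoc)
    also have "cnj \<dots> = of_real (lam n) * L2_inner f (e n)" by (simp add: L2_inner_cnj)
    finally show ?thesis by (simp add: algebra_simps)
  qed
  then show "of_real (lam n) \<noteq> \<mu> \<Longrightarrow> L2_inner f (e n) = 0" for n
    using *[of n] by auto
  show "\<exists>n. \<mu> = of_real (lam n)"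
  proof (rule ccontr)
    assume "\<not> ?thesis"
    then have "\<forall>n. L2_inner f (e n) = 0" using * by auto
    then show False using basis fL2 nz by (auto simp: is_orthonormal_basis_def)
  qed
qed

theorem corollary5p6:
  fixes p :: ereal and R :: real
  assumes "0 < p" and "0 < R"
  shows "let F = (indicator (lp_phase_ball p R) :: 'd::finite phase \<Rightarrow> complex);
             S = (\<lambda>f t. 2 ^ CARD('d) * parity f t);
             L = weyl_transform F;
             lam = (\<lambda>n :: nat^'d. (4 * pi) ^ CARD('d) * (- 1) ^ (\<Sum>j\<in>UNIV. n $ j)
                      * (LINT r:(lp_radial_ball p R :: (real^'d) set)|lborel.
                           (\<Prod>j\<in>UNIV. exp (- 2 * pi * (r $ j)\<^sup>2)
                                         * laguerre (n $ j) (4 * pi * (r $ j)\<^sup>2) * r $ j)))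
         in is_weyl_transform F L
          \<and> is_op_convolution F S (F \<star> S)
          \<and> (\<forall>f\<in>L2. AE t in lborel. L f t = (F \<star> S) f t)
          \<and> is_orthonormal_basis (hermite_fun :: nat^'d \<Rightarrow> real^'d \<Rightarrow> complex)
          \<and> (\<forall>n. is_eigenfunction L (of_real (lam n)) (hermite_fun n))
          \<and> (\<forall>\<mu> f. is_eigenfunction L \<mu> f \<longrightarrow>
               (\<exists>n. \<mu> = of_real (lam n)) \<and>
               (\<forall>n. of_real (lam n) \<noteq> \<mu> \<longrightarrow> L2_inner f (hermite_fun n) = 0))"
proof -
  define W where "W = (lp_radial_ball p R :: (real^'d) set)"
  define F where "F = (indicator (lp_phase_ball p R) :: 'd phase \<Rightarrow> complex)"
  define S :: "'d operator" where "S = (\<lambda>f t. 2 ^ CARD('d) * parity f t)"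
  define L where "L = weyl_transform F"
  define lam where "lam = (\<lambda>n :: nat^'d. (4 * pi) ^ CARD('d) * (- 1) ^ (\<Sum>j\<in>UNIV. n $ j)
                      * (LINT r:W|lborel. (\<Prod>j\<in>UNIV. exp (- 2 * pi * (r $ j)\<^sup>2)
                                         * laguerre (n $ j) (4 * pi * (r $ j)\<^sup>2) * r $ j)))"
  have W: "W \<in> sets borel" "\<And>r i. r \<in> W \<Longrightarrow> 0 \<le> r $ i"
    unfolding W_def by (rule lp_radial_ball_borel, rule lp_radial_ball_nonneg)
  have FW: "F = (\<lambda>z. indicator W (radii z))"
    by (auto simp: F_def W_def indicator_def mem_lp_phase_ball_iff)
  have "lp_phase_ball p R = radii -` W" by (auto simp: W_def mem_lp_phase_ball_iff)
  then have ball: "(lp_phase_ball p R :: 'd phase set) \<in> sets borel"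
    using measurable_sets[OF measurable_radii W(1)] by simp
  have "is_weyl_transform F (indicator_weyl_operator (lp_phase_ball p R))"
    unfolding F_def by (rule indicator_weyl_operator_is_weyl_transform[OF ball emeasure_lp_phase_ball_finite[OF assms]])
  then have weyl: "is_weyl_transform F L"
    unfolding L_def weyl_transform_def by (rule someI[where P = "is_weyl_transform F"])
  have conv: "is_op_convolution F S = is_weyl_transform F"
    unfolding S_def by (rule is_op_convolution_iff_is_weyl_transform)
  then have conv_eq: "F \<star> S = L"
    by (simp add: op_convolution_def L_def weyl_transform_def)
  have basis: "is_orthonormal_basis (hermite_fun :: nat^'d \<Rightarrow> real^'d \<Rightarrow> complex)"
    by (rule hermite_fun_basis)
  have eig: "is_eigenfunction L (of_real (lam n)) (hermite_fun n)" for n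
    unfolding lam_def by (rule polyradial_weyl_hermite[OF W weyl[unfolded FW]])
  have sym: "L2_inner (L f) g = L2_inner f (L g)" if "f \<in> L2" "g \<in> L2" for f g
    using that by (intro weyl_transform_real_symmetric[OF weyl]) (auto simp: F_def indicator_def)
  have LL2: "L f \<in> L2" if "f \<in> L2" for f using weyl that by (simp add: is_weyl_transform_def)
  note spec = spectrum_from_eigenbasis[where L=L and lam=lam, OF basis eig LL2 sym]
  show ?thesis
    unfolding Let_def F_def[symmetric] S_def[symmetric] L_def[symmetric] W_def[symmetric] lam_def[symmetric]
    using weyl conv conv_eq basis eig spec by auto
qed

end
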